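(* Let $\lambda>0$, $c>0$, $p\in[0,1]$, $q=1-p$, and let $(X(t),Y(t))$ be the planar random motion defined in the context. For $\alpha,\beta\in\mathbb{R}$ put $$A=\frac12\sqrt{4\lambda^2p(1-p)-c^2(\alpha^2+\beta^2)+2\sqrt{c^4\alpha^2\beta^2-\lambda^4(2p-1)^2}},$$ $$B=\frac12\sqrt{4\lambda^2p(1-p)-c^2(\alpha^2+\beta^2)-2\sqrt{c^4\alpha^2\beta^2-\lambda^4(2p-1)^2}},$$ and $$k_0=\frac{2\lambda^2-c^2(\alpha^2+\beta^2)-2(A-B)^2}{8AB},\qquad k_1=\frac{\lambda^3-\lambda c^2(\alpha^2+\beta^2)-\lambda(A-B)^2}{4AB(A+B)},$$ $$k_2=\frac{2\lambda^2-c^2(\alpha^2+\beta^2)-2(A+B)^2}{8AB},\qquad k_3=\frac{\lambda^3-\lambda c^2(\alpha^2+\beta^2)-\lambda(A+B)^2}{4AB(A-B)}.$$ Then for every $t>0$ and all $\alpha,\beta\in\mathbb{R}$ for which $AB(A+B)(A-B)\ne0$, $$\mathbb{E}\left[e^{i(\alpha X(t)+\beta Y(t))}\right]=e^{-\lambda t}\Big\{k_0\cosh\big((A+B)t\big)+k_1\sinh\big((A+B)t\big)-k_2\cosh\big((A-B)t\big)-k_3\sinh\big((A-B)t\big)\Big\}.$$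
   Context: Model. Let $d_j=(\cos(\pi j/2),\sin(\pi j/2))$, with index $j$ taken modulo 4. Let $N(t)$ be a homogeneous Poisson process of rate $\lambda$. The direction process $D(t)$ takes values in $\{d_0,d_1,d_2,d_3\}$; $D(0)$ is uniformly distributed and independent of $N$; $D$ is constant between Poisson events; at each Poisson event, independently of everything else, $D$ jumps from its current value $d_j$ to $d_{j+1}$ with probability $p$ (counterclockwise turn), to $d_{j-1}$ with probability $q=1-p$ (clockwise turn); there is no reflection. The motion starts at the origin and has speed $c$: $(X(t),Y(t))=c\int_0^t D(\tau)\,d\tau$. All square roots are complex square roots; the right-hand side does not depend on the choice of the roots. *)

theory Defs
  imports "HOL-Probability.Probability"
begin

text \<open>
  A homogeneous Poisson process on \<open>[0, \<infinity>)\<close>: a right-continuous, nondecreasing counting process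
  started at 0 with independent, Poisson distributed increments.
  (\<open>indep_vars\<close> includes the measurability of the increments.)
\<close>

locale poisson_process = prob_space M for M :: "'a measure" +
  fixes rate :: real and N :: "real \<Rightarrow> 'a \<Rightarrow> nat"
  assumes N_0: "\<And>\<omega>. \<omega> \<in> space M \<Longrightarrow> N 0 \<omega> = 0"
    and N_mono: "\<And>\<omega>. \<omega> \<in> space M \<Longrightarrow> mono_on {0..} (\<lambda>t. N t \<omega>)"
    and N_right_continuous:
      "\<And>\<omega> t. \<omega> \<in> space M \<Longrightarrow> t \<ge> 0 \<Longrightarrow> continuous (at_right t) (\<lambda>s. real (N s \<omega>))"
    and N_increments_indep:
      "\<And>(\<tau> :: nat \<Rightarrow> real) n. 0 \<le> \<tau> 0 \<Longrightarrow> (\<And>i. i < n \<Longrightarrow> \<tau> i \<le> \<tau> (Suc i)) \<Longrightarrow>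
         indep_vars (\<lambda>_. count_space UNIV) (\<lambda>i \<omega>. N (\<tau> (Suc i)) \<omega> - N (\<tau> i) \<omega>) {..<n}"
    and N_increments_poisson:
      "\<And>s t. 0 \<le> s \<Longrightarrow> s < t \<Longrightarrow>
         distr M (count_space UNIV) (\<lambda>\<omega>. N t \<omega> - N s \<omega>) = measure_pmf (poisson_pmf (rate * (t - s)))"

definition dir :: "int \<Rightarrow> real \<times> real" where
  "dir j = (cos (pi * of_int j / 2), sin (pi * of_int j / 2))"

text \<open>
  The three kinds of random input of the motion: the whole Poisson process, the initial direction,
  and for each \<open>k\<close> the coin deciding the turn at the Poisson event number \<open>k\<close> (counted from 0).
\<close>

datatype source = Clock | Start | Turn nat

definition (in prob_space) source_events ::
    "(real \<Rightarrow> 'a \<Rightarrow> nat) \<Rightarrow> ('a \<Rightarrow> int) \<Rightarrow> (nat \<Rightarrow> 'a \<Rightarrow> bool) \<Rightarrow> source \<Rightarrow> 'a set set" where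
  "source_events N J \<xi> s = (case s of
      Clock \<Rightarrow> sets (vimage_algebra (space M) (\<lambda>\<omega>. \<lambda>t\<in>{0..}. N t \<omega>) (Pi\<^sub>M {0..} (\<lambda>_. count_space UNIV)))
    | Start \<Rightarrow> sets (vimage_algebra (space M) J (count_space UNIV))
    | Turn k \<Rightarrow> sets (vimage_algebra (space M) (\<xi> k) (count_space UNIV)))"

text \<open>
  The direction is \<open>dir (J \<omega>)\<close> before the first Poisson event, and the event number \<open>k\<close> changes the
  index by \<open>+1\<close> (counterclockwise) if \<open>\<xi> k \<omega>\<close> holds and by \<open>-1\<close> (clockwise) otherwise. The index is
  a representative in \<open>int\<close> of the index modulo 4, since \<open>dir (j + 4) = dir j\<close>.
\<close>

locale orthogonal_direction_process = poisson_process M rate N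
  for M :: "'a measure" and rate :: real and N :: "real \<Rightarrow> 'a \<Rightarrow> nat" +
  fixes p :: real and D :: "real \<Rightarrow> 'a \<Rightarrow> real \<times> real"
  assumes direction_process:
    "\<exists>(J :: 'a \<Rightarrow> int) (\<xi> :: nat \<Rightarrow> 'a \<Rightarrow> bool).
       random_variable (count_space UNIV) J \<and>
       (\<forall>k. random_variable (count_space UNIV) (\<xi> k)) \<and>
       distr M (count_space UNIV) J = measure_pmf (pmf_of_set {0, 1, 2, 3}) \<and>
       (\<forall>k. distr M (count_space UNIV) (\<xi> k) = measure_pmf (bernoulli_pmf p)) \<and>
       indep_sets (source_events N J \<xi>) UNIV \<and>
       (\<forall>\<omega>\<in>space M. \<forall>t\<ge>0. D t \<omega> = dir (J \<omega> + (\<Sum>k<N t \<omega>. if \<xi> k \<omega> then 1 else - 1)))"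

end

theory Submission
  imports Defs
begin

text \<open>
  Instead of conditioning on the jump times, sample the motion on the grid \<open>0, t/n, 2t/n, \<dots>, t\<close>.
  Let \<open>\<phi> s j\<close> solve the backward equation \<open>\<phi>' = generator \<phi>\<close> with \<open>\<phi> 0 j = 1\<close>. Replacing, in one step
  \<open>h = t/n\<close>, the direction at the end of the step by the direction at its beginning while \<open>\<phi> s\<close>
  becomes \<open>\<phi> (s + h)\<close> changes the expectation of the phase factor times \<open>\<phi>\<close> by \<open>O(h\<^sup>2)\<close>, because two or
  more Poisson events have probability \<open>O(h\<^sup>2)\<close>. Summing the \<open>n\<close> errors, the characteristic function
  of the Riemann sum tends to the mean of \<open>\<phi> t j\<close> over the initial direction \<open>j\<close>; the Riemann sums
  themselves tend to the position at time \<open>t\<close>. The generator, shifted by \<open>\<lambda>\<close>, has the characteristic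
  polynomial \<open>(\<mu>\<^sup>2 - (A + B)\<^sup>2) (\<mu>\<^sup>2 - (A - B)\<^sup>2)\<close>, whence \<open>\<phi>\<close> is explicit.
\<close>

section \<open>Independence of the past and the next step on a grid\<close>

locale turning_motion = poisson_process M rate N
  for M :: "'a measure" and rate :: real and N :: "real \<Rightarrow> 'a \<Rightarrow> nat" +
  fixes p :: real and J :: "'a \<Rightarrow> int" and \<xi> :: "nat \<Rightarrow> 'a \<Rightarrow> bool"
  assumes rate_pos: "0 < rate" and p_nonneg: "0 \<le> p" and p_le_1: "p \<le> 1"
    and random_variable_start: "random_variable (count_space UNIV) J"
    and random_variable_turn: "\<And>k. random_variable (count_space UNIV) (\<xi> k)"
    and distr_start: "distr M (count_space UNIV) J = measure_pmf (pmf_of_set {0, 1, 2, 3})"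
    and distr_turn: "\<And>k. distr M (count_space UNIV) (\<xi> k) = measure_pmf (bernoulli_pmf p)"
    and indep_sources: "indep_sets (source_events N J \<xi>) UNIV"
begin

text \<open>The source \<open>Clock\<close> packaged as a measure for the sake of its sigma-algebra:
  measurability rules then show that events about grid increments belong to this source, which is
  what independence of the sources asks for.\<close>

definition clock :: "'a measure" where
  "clock = vimage_algebra (space M) (\<lambda>\<omega>. \<lambda>t\<in>{0..}. N t \<omega>) (Pi\<^sub>M {0..} (\<lambda>_. count_space UNIV))"

definition index :: "real \<Rightarrow> 'a \<Rightarrow> int" where
  "index t \<omega> = J \<omega> + (\<Sum>k<N t \<omega>. if \<xi> k \<omega> then 1 else - 1)"

definition incr :: "real \<Rightarrow> nat \<Rightarrow> 'a \<Rightarrow> nat" where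
  "incr h i \<omega> = N (real (Suc i) * h) \<omega> - N (real i * h) \<omega>"

text \<open>
  The past \<open>past h k\<close> has countably many values and determines the motion on the grid
  \<open>0, h, \<dots>, k h\<close>; \<open>next_step h k\<close> is independent of it although the number of the next coin is random.
\<close>

definition past :: "real \<Rightarrow> nat \<Rightarrow> 'a \<Rightarrow> nat list \<times> int \<times> bool list" where
  "past h k \<omega> = (map (\<lambda>i. incr h i \<omega>) [0..<k], J \<omega>, map (\<lambda>l. \<xi> l \<omega>) [0..<N (real k * h) \<omega>])"

definition next_step :: "real \<Rightarrow> nat \<Rightarrow> 'a \<Rightarrow> nat \<times> bool" where
  "next_step h k \<omega> = (incr h k \<omega>, \<xi> (N (real k * h) \<omega>) \<omega>)"

section \<open>The clock sigma-algebra and the grid increments\<close>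

lemma space_clock [simp]: "space clock = space M"
  by (simp add: clock_def)

lemma sets_clock: "sets clock = source_events N J \<xi> Clock"
  by (simp add: clock_def source_events_def)

lemma sets_clock_subset: "sets clock \<subseteq> events"
  unfolding sets_clock using indep_sources by (simp add: indep_sets_def)

lemma measurable_clock_N:
  assumes "0 \<le> t"
  shows "N t \<in> clock \<rightarrow>\<^sub>M count_space UNIV"
proof -
  have "(\<lambda>\<omega>. \<lambda>t\<in>{0..}. N t \<omega>) \<in> clock \<rightarrow>\<^sub>M Pi\<^sub>M {0..} (\<lambda>_. count_space UNIV)"
    unfolding clock_def by (rule measurable_vimage_algebra1) (auto simp: space_PiM)
  then have "(\<lambda>\<omega>. (\<lambda>t\<in>{0..}. N t \<omega>) t) \<in> clock \<rightarrow>\<^sub>M count_space UNIV"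
    by (rule measurable_compose[OF _ measurable_component_singleton]) (use assms in auto)
  then show ?thesis using assms by simp
qed

lemma measurable_clock_incr:
  assumes "0 \<le> h"
  shows "incr h i \<in> clock \<rightarrow>\<^sub>M count_space UNIV"
proof -
  have [measurable]: "N (real (Suc i) * h) \<in> clock \<rightarrow>\<^sub>M count_space UNIV"
    "N (real i * h) \<in> clock \<rightarrow>\<^sub>M count_space UNIV"
    by (rule measurable_clock_N; use assms in simp)+
  show ?thesis unfolding incr_def[abs_def] by measurable
qed

lemma measurable_clock_imp: "f \<in> clock \<rightarrow>\<^sub>M K \<Longrightarrow> f \<in> M \<rightarrow>\<^sub>M K"
  using sets_clock_subset unfolding measurable_def space_clock by blast

text \<open>Telescoping from \<open>N 0 \<omega> = 0\<close>; monotonicity of the path keeps the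
  subtraction of naturals in \<open>incr\<close> from truncating. The first \<open>k\<close>
  increments thus fix how many coins are used up to time \<open>real k * h\<close>.\<close>

lemma N_grid:
  assumes "0 \<le> h" "\<omega> \<in> space M"
  shows "N (real k * h) \<omega> = (\<Sum>i<k. incr h i \<omega>)"
proof (induction k)
  case 0
  then show ?case using N_0[OF assms(2)] by simp
next
  case (Suc k)
  have "N (real k * h) \<omega> \<le> N (real (Suc k) * h) \<omega>"
    by (rule mono_onD[OF N_mono[OF assms(2)]])
      (use assms(1) in \<open>auto simp: algebra_simps\<close>)
  then have "N (real (Suc k) * h) \<omega> = N (real k * h) \<omega> + incr h k \<omega>"
    by (simp add: incr_def)
  then show ?case using Suc by simp
qed

text \<open>Independence of the sources, applied to the finite set of \<open>Clock\<close>,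
  \<open>Start\<close> and the first \<open>length bs\<close> turns. The clock event
  \<open>E\<close> is kept arbitrary, so the number of coins need not match the increments that it
  describes.\<close>

lemma prob_atom:
  assumes "E \<in> sets clock"
  shows "prob (E \<inter> {\<omega>\<in>space M. J \<omega> = j} \<inter> {\<omega>\<in>space M. \<forall>l<length bs. \<xi> l \<omega> = bs ! l}) =
    prob E * prob {\<omega>\<in>space M. J \<omega> = j} * (\<Prod>l<length bs. pmf (bernoulli_pmf p) (bs ! l))"
proof -
  let ?m = "length bs"
  define S where "S = insert Clock (insert Start (Turn ` {..<?m}))"
  define A where "A s = (case s of Clock \<Rightarrow> E | Start \<Rightarrow> {\<omega>\<in>space M. J \<omega> = j}
    | Turn l \<Rightarrow> {\<omega>\<in>space M. \<xi> l \<omega> = bs ! l})" for s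
  have "E \<subseteq> space M" using sets.sets_into_space[OF assms] by simp
  have "A s \<in> source_events N J \<xi> s" for s
  proof (cases s)
    case Clock
    then show ?thesis using assms by (simp add: A_def sets_clock)
  next
    case Start
    have "J -` {j} \<inter> space M \<in> sets (vimage_algebra (space M) J (count_space UNIV))"
      by (rule in_vimage_algebra) simp
    then show ?thesis using Start
      by (simp add: A_def source_events_def vimage_def Int_def conj_commute)
  next
    case (Turn l)
    have "\<xi> l -` {bs ! l} \<inter> space M \<in> sets (vimage_algebra (space M) (\<xi> l) (count_space UNIV))"
      by (rule in_vimage_algebra) simp
    then show ?thesis using Turn
      by (simp add: A_def source_events_def vimage_def Int_def conj_commute)
  qed
  then have "prob (\<Inter>s\<in>S. A s) = (\<Prod>s\<in>S. prob (A s))"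
    by (intro indep_setsD[OF indep_sources]) (auto simp: S_def)
  moreover have "(\<Inter>s\<in>S. A s) =
      E \<inter> {\<omega>\<in>space M. J \<omega> = j} \<inter> {\<omega>\<in>space M. \<forall>l<length bs. \<xi> l \<omega> = bs ! l}"
    using \<open>E \<subseteq> space M\<close> by (auto simp: S_def A_def)
  moreover have "(\<Prod>s\<in>S. prob (A s)) =
      prob E * (prob {\<omega>\<in>space M. J \<omega> = j} * (\<Prod>l<?m. prob {\<omega>\<in>space M. \<xi> l \<omega> = bs ! l}))"
    unfolding S_def
    by (subst prod.insert, simp, force, subst prod.insert, simp, force)
      (simp add: A_def prod.reindex inj_on_def)
  moreover have "prob {\<omega>\<in>space M. \<xi> l \<omega> = b} = pmf (bernoulli_pmf p) b" for l b
  proof -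
    have "prob (\<xi> l -` {b} \<inter> space M) = measure (distr M (count_space UNIV) (\<xi> l)) {b}"
      by (rule measure_distr[symmetric]) (use random_variable_turn in auto)
    then show ?thesis
      by (simp add: distr_turn measure_pmf_single vimage_def Int_def conj_commute)
  qed
  ultimately show ?thesis by simp
qed

lemma prob_incr:
  assumes "0 < h"
  shows "prob {\<omega>\<in>space M. incr h k \<omega> = a} = pmf (poisson_pmf (rate * h)) a"
proof -
  let ?D = "\<lambda>\<omega>. N (real (Suc k) * h) \<omega> - N (real k * h) \<omega>"
  have m: "?D \<in> M \<rightarrow>\<^sub>M count_space UNIV"
    using measurable_clock_incr[THEN measurable_clock_imp, of h k] assms
    by (simp add: incr_def[abs_def])
  have "distr M (count_space UNIV) ?D = measure_pmf (poisson_pmf (rate * (real (Suc k) * h - real k * h)))"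
    by (rule N_increments_poisson) (use assms in \<open>auto simp: algebra_simps\<close>)
  also have "real (Suc k) * h - real k * h = h" by (simp add: algebra_simps)
  finally have "measure (distr M (count_space UNIV) ?D) {a} = pmf (poisson_pmf (rate * h)) a"
    by (simp add: measure_pmf_single)
  then show ?thesis
    by (subst (asm) measure_distr[OF m]) (auto simp: incr_def vimage_def Int_def conj_commute)
qed

lemma prob_incrs:
  assumes "0 < h"
  shows "prob {\<omega>\<in>space M. \<forall>i<k. incr h i \<omega> = f i} = (\<Prod>i<k. pmf (poisson_pmf (rate * h)) (f i))"
proof (cases "k = 0")
  case True
  then show ?thesis by (simp add: prob_space)
next
  case False
  have iv: "indep_vars (\<lambda>_. count_space UNIV) (incr h) {..<k}"
    using N_increments_indep[of "\<lambda>i. real i * h" k] assms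
    by (simp add: incr_def[abs_def] algebra_simps)
  have "prob (\<Inter>i\<in>{..<k}. incr h i -` {f i} \<inter> space M) = (\<Prod>i<k. prob (incr h i -` {f i} \<inter> space M))"
    by (rule indep_varsD_finite[OF iv]) (use False in auto)
  moreover have "(\<Inter>i\<in>{..<k}. incr h i -` {f i} \<inter> space M) = {\<omega>\<in>space M. \<forall>i<k. incr h i \<omega> = f i}"
    using False by auto
  moreover have "incr h i -` {f i} \<inter> space M = {\<omega>\<in>space M. incr h i \<omega> = f i}" for i by auto
  ultimately show ?thesis using prob_incr[OF assms] by simp
qed

text \<open>The number of coins recorded in \<open>past\<close> is random. Once the increments agree
  with \<open>ms\<close>, it equals \<open>sum_list ms\<close> by \<open>N_grid\<close>; the length
  conditions therefore turn the event into one about finitely many fixed coordinates.\<close>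

lemma past_eq_iff:
  assumes "0 < h" "\<omega> \<in> space M" "length ms = k" "length bs = sum_list ms"
  shows "past h k \<omega> = (ms, j, bs) \<longleftrightarrow>
    (\<forall>i<k. incr h i \<omega> = ms ! i) \<and> J \<omega> = j \<and> (\<forall>l<length bs. \<xi> l \<omega> = bs ! l)"
proof -
  have "N (real k * h) \<omega> = length bs" if "\<forall>i<k. incr h i \<omega> = ms ! i"
    using N_grid[of h \<omega> k] assms that by (simp add: sum_list_sum_nth atLeast0LessThan)
  then show ?thesis
    using assms(3) by (auto simp: past_def list_eq_iff_nth_eq)
qed

text \<open>Triples that violate these length conditions are never attained, so events prescribing
  such a value of \<open>past\<close> are empty.\<close>

lemma past_length:
  assumes "0 < h" "\<omega> \<in> space M" "past h k \<omega> = (ms, j, bs)"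
  shows "length ms = k" "length bs = sum_list ms"
proof -
  have "ms = map (\<lambda>i. incr h i \<omega>) [0..<k]" "length bs = N (real k * h) \<omega>"
    using assms(3) by (auto simp: past_def)
  moreover have "N (real k * h) \<omega> = (\<Sum>i<k. incr h i \<omega>)"
    using N_grid assms by simp
  ultimately show "length ms = k" "length bs = sum_list ms"
    by (simp_all add: sum_list_sum_nth atLeast0LessThan)
qed

lemma clock_incrs_event:
  assumes "0 < h"
  shows "{\<omega>\<in>space M. \<forall>i<k. incr h i \<omega> = f i} \<in> sets clock"
proof -
  have "{\<omega>\<in>space clock. incr h i \<omega> = f i} \<in> sets clock" for i
  proof -
    have "incr h i -` {f i} \<inter> space clock \<in> sets clock"
      by (rule measurable_sets[OF measurable_clock_incr]) (use assms in simp_all)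
    moreover have "incr h i -` {f i} \<inter> space clock = {\<omega>\<in>space clock. incr h i \<omega> = f i}"
      by blast
    ultimately show ?thesis by (simp only:)
  qed
  then have "{\<omega>\<in>space clock. \<forall>i\<in>{..<k}. incr h i \<omega> = f i} \<in> sets clock"
    by (intro sets.sets_Collect_finite_All finite_lessThan)
  then show ?thesis by (simp only: space_clock lessThan_iff Ball_def)
qed

text \<open>On a fixed value of the past, the random number of the next coin is the constant
  \<open>length bs\<close>. The joint event is then again of the form in \<open>prob_atom\<close>,
  with one more increment and one more coin, and the last factors of the two products split
  off.\<close>

lemma prob_past_next_step:
  assumes h: "0 < h"
  shows "prob {\<omega>\<in>space M. past h k \<omega> = w \<and> next_step h k \<omega> = v} =
    prob {\<omega>\<in>space M. past h k \<omega> = w} *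
      pmf (pair_pmf (poisson_pmf (rate * h)) (bernoulli_pmf p)) v"
proof -
  obtain ms j bs where w: "w = (ms, j, bs)" by (cases w)
  obtain a b where v: "v = (a, b)" by (cases v)
  show ?thesis
  proof (cases "length ms = k \<and> length bs = sum_list ms")
    case False
    then have "past h k \<omega> \<noteq> w" if "\<omega> \<in> space M" for \<omega>
      using past_length[OF h that] w by blast
    then have "{\<omega>\<in>space M. past h k \<omega> = w} = {}" "{\<omega>\<in>space M. past h k \<omega> = w \<and> next_step h k \<omega> = v} = {}"
      by auto
    then show ?thesis by (simp only: measure_empty mult_zero_left)
  next
    case True
    let ?E = "\<lambda>k ms. {\<omega>\<in>space M. \<forall>i<k. incr h i \<omega> = ms ! i}"
    let ?T = "\<lambda>bs. {\<omega>\<in>space M. \<forall>l<length bs. \<xi> l \<omega> = bs ! l}"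
    have 1: "{\<omega>\<in>space M. past h k \<omega> = w} = ?E k ms \<inter> {\<omega>\<in>space M. J \<omega> = j} \<inter> ?T bs"
      using past_eq_iff[OF h _ conjunct1[OF True] conjunct2[OF True]] w by auto
    \<comment> \<open>Exactly one coin is appended, whatever the increment \<open>a\<close> is.
      Since \<open>length (bs @ [b])\<close> may differ from \<open>sum_list (ms @ [a])\<close>, the
      joint event is not a value of \<open>past h (Suc k)\<close> in general.\<close>
    have *: "past h k \<omega> = w \<and> next_step h k \<omega> = v \<longleftrightarrow>
      (\<forall>i<Suc k. incr h i \<omega> = (ms @ [a]) ! i) \<and> J \<omega> = j \<and> (\<forall>l<Suc (length bs). \<xi> l \<omega> = (bs @ [b]) ! l)"
      if "\<omega> \<in> space M" for \<omega>
    proof -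
      have len: "N (real k * h) \<omega> = length bs" if "\<forall>i<k. incr h i \<omega> = ms ! i"
        using N_grid[of h \<omega> k] \<open>\<omega> \<in> space M\<close> h True that by (simp add: sum_list_sum_nth atLeast0LessThan)
      show ?thesis
        using past_eq_iff[OF h that conjunct1[OF True] conjunct2[OF True]] len True
        by (auto simp: w v next_step_def nth_append less_Suc_eq)
    qed
    have 2: "{\<omega>\<in>space M. past h k \<omega> = w \<and> next_step h k \<omega> = v} =
        ?E (Suc k) (ms @ [a]) \<inter> {\<omega>\<in>space M. J \<omega> = j} \<inter> ?T (bs @ [b])"
      using * by auto
    show ?thesis
      unfolding 1 2 prob_atom[OF clock_incrs_event[OF h]] prob_incrs[OF h]
      using True by (simp add: v pmf_pair nth_append)
  qed
qed

section \<open>Measurability and product law of the past and the next step\<close>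

lemma measurable_incr:
  assumes "0 < h"
  shows "incr h i \<in> M \<rightarrow>\<^sub>M count_space UNIV"
  using measurable_clock_incr[THEN measurable_clock_imp, of h i] assms by simp

text \<open>Serves \<open>measurable_past\<close>: the type of values is countable, so it is enough
  that each single value is attained on an event.\<close>

lemma past_event:
  assumes h: "0 < h"
  shows "{\<omega>\<in>space M. past h k \<omega> = w} \<in> events"
proof -
  obtain ms j bs where w: "w = (ms, j, bs)" by (cases w)
  show ?thesis
  proof (cases "length ms = k \<and> length bs = sum_list ms")
    case False
    then have "{\<omega>\<in>space M. past h k \<omega> = w} = {}"
      using past_length[OF h] w by blast
    then show ?thesis by (simp only: sets.empty_sets)
  next
    case True
    have "{\<omega>\<in>space M. past h k \<omega> = w} = {\<omega>\<in>space M. \<forall>i<k. incr h i \<omega> = ms ! i} \<inter>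
        (J -` {j} \<inter> space M) \<inter> {\<omega>\<in>space M. \<forall>l\<in>{..<length bs}. \<xi> l \<omega> = bs ! l}"
      using past_eq_iff[OF h _ conjunct1[OF True] conjunct2[OF True]] w by auto
    moreover have "{\<omega>\<in>space M. \<forall>i<k. incr h i \<omega> = ms ! i} \<in> events"
      using clock_incrs_event[OF h] sets_clock_subset by blast
    moreover have "J -` {j} \<inter> space M \<in> events"
      using random_variable_start by (rule measurable_sets) simp
    moreover have "{\<omega>\<in>space M. \<forall>l\<in>{..<length bs}. \<xi> l \<omega> = bs ! l} \<in> events"
    proof (rule sets.sets_Collect_finite_All)
      fix l
      have "\<xi> l -` {bs ! l} \<inter> space M \<in> events"
        using random_variable_turn by (rule measurable_sets) simp
      then show "{\<omega>\<in>space M. \<xi> l \<omega> = bs ! l} \<in> events"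
        by (simp add: vimage_def Int_def conj_commute)
    qed simp
    ultimately show ?thesis by (simp only: sets.Int)
  qed
qed

lemma measurable_past:
  assumes "0 < h"
  shows "past h k \<in> M \<rightarrow>\<^sub>M count_space UNIV"
  using past_event[OF assms]
  by (simp add: measurable_count_space_eq2_countable vimage_def Int_def conj_commute)

lemma measurable_next_step:
  assumes h: "0 < h"
  shows "next_step h k \<in> M \<rightarrow>\<^sub>M count_space UNIV"
proof -
  have 1: "N (real k * h) \<in> M \<rightarrow>\<^sub>M count_space UNIV"
    using measurable_clock_imp[OF measurable_clock_N] h by simp
  have 2: "(\<lambda>\<omega>. \<xi> (N (real k * h) \<omega>) \<omega>) \<in> M \<rightarrow>\<^sub>M count_space UNIV"
    by (rule measurable_compose_countable[OF random_variable_turn 1])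
  have "next_step h k \<in> M \<rightarrow>\<^sub>M count_space UNIV \<Otimes>\<^sub>M count_space UNIV"
    unfolding next_step_def[abs_def] by (rule measurable_Pair[OF measurable_incr[OF h] 2])
  then show ?thesis by (simp add: pair_measure_countable)
qed

text \<open>Both measures live on a countable type, so they agree as soon as they agree on
  singletons, which is \<open>prob_past_next_step\<close>.\<close>

lemma distr_past_next_step:
  assumes h: "0 < h"
  shows "distr M (count_space UNIV) (\<lambda>\<omega>. (past h k \<omega>, next_step h k \<omega>)) =
    distr M (count_space UNIV) (past h k) \<Otimes>\<^sub>M
      measure_pmf (pair_pmf (poisson_pmf (rate * h)) (bernoulli_pmf p))"
    (is "?L = ?D \<Otimes>\<^sub>M measure_pmf ?P")
proof (rule measure_eqI_countable[of _ UNIV])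
  have "sets (?D \<Otimes>\<^sub>M measure_pmf ?P) = sets (count_space UNIV \<Otimes>\<^sub>M count_space UNIV)"
    by (rule sets_pair_measure_cong) auto
  then show "sets (?D \<Otimes>\<^sub>M measure_pmf ?P) = Pow UNIV"
    unfolding pair_measure_countable[OF countableI_type countableI_type] by simp
  fix z :: "(nat list \<times> int \<times> bool list) \<times> (nat \<times> bool)"
  obtain w v where z: "z = (w, v)" by (cases z)
  have m: "(\<lambda>\<omega>. (past h k \<omega>, next_step h k \<omega>)) \<in> M \<rightarrow>\<^sub>M count_space UNIV"
    using measurable_Pair[OF measurable_past[OF h] measurable_next_step[OF h]]
    by (simp add: pair_measure_countable)
  have "emeasure ?L {z} = emeasure M {\<omega>\<in>space M. past h k \<omega> = w \<and> next_step h k \<omega> = v}"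
    by (simp add: emeasure_distr[OF m] z vimage_def Int_def conj_commute)
  also have "\<dots> = ennreal (prob {\<omega>\<in>space M. past h k \<omega> = w} * pmf ?P v)"
    by (simp add: emeasure_eq_measure prob_past_next_step[OF h])
  also have "\<dots> = emeasure ?D {w} * emeasure (measure_pmf ?P) {v}"
    by (simp add: emeasure_distr[OF measurable_past[OF h]] emeasure_pmf_single ennreal_mult
        emeasure_eq_measure vimage_def Int_def conj_commute)
  also have "\<dots> = emeasure (?D \<Otimes>\<^sub>M measure_pmf ?P) ({w} \<times> {v})"
    by (rule measure_pmf.emeasure_pair_measure_Times[symmetric]) auto
  finally show "emeasure ?L {z} = emeasure (?D \<Otimes>\<^sub>M measure_pmf ?P) {z}"
    by (simp add: z)
qed simp_all

text \<open>Fubini for the product law. Indicators of the next step suffice, because a step is later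
  split according to its outcome.\<close>

lemma expectation_past_next_step:
  fixes f :: "nat list \<times> int \<times> bool list \<Rightarrow> complex"
  assumes h: "0 < h" and bound: "\<And>w. norm (f w) \<le> C"
  shows "expectation (\<lambda>\<omega>. f (past h k \<omega>) * indicator S (next_step h k \<omega>)) =
    expectation (\<lambda>\<omega>. f (past h k \<omega>)) *
      measure_pmf.prob (pair_pmf (poisson_pmf (rate * h)) (bernoulli_pmf p)) S"
proof -
  let ?D = "distr M (count_space UNIV) (past h k)"
  let ?P = "pair_pmf (poisson_pmf (rate * h)) (bernoulli_pmf p)"
  let ?g = "\<lambda>z. f (fst z) * indicator S (snd z)"
  interpret D: prob_space ?D by (rule prob_space_distr[OF measurable_past[OF h]])
  interpret P: prob_space "measure_pmf ?P" by (rule measure_pmf.prob_space_axioms)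
  interpret DP: pair_prob_space ?D "measure_pmf ?P" ..
  have m: "(\<lambda>\<omega>. (past h k \<omega>, next_step h k \<omega>)) \<in> M \<rightarrow>\<^sub>M count_space UNIV"
    using measurable_Pair[OF measurable_past[OF h] measurable_next_step[OF h]]
    by (simp add: pair_measure_countable)
  have "0 \<le> C" using bound order_trans[OF norm_ge_zero] by blast
  have "sets (?D \<Otimes>\<^sub>M measure_pmf ?P) = sets (count_space UNIV \<Otimes>\<^sub>M count_space UNIV)"
    by (rule sets_pair_measure_cong) auto
  then have "sets (?D \<Otimes>\<^sub>M measure_pmf ?P) = sets (count_space UNIV)"
    unfolding pair_measure_countable[OF countableI_type countableI_type] by simp
  then have mg: "?g \<in> borel_measurable (?D \<Otimes>\<^sub>M measure_pmf ?P)"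
    by (subst measurable_cong_sets[OF _ refl]) (assumption, simp)
  have int: "integrable (?D \<Otimes>\<^sub>M measure_pmf ?P) ?g"
    by (rule DP.integrable_const_bound[of _ C])
      (use bound \<open>0 \<le> C\<close> mg in \<open>auto simp: indicator_def\<close>)
  have "expectation (\<lambda>\<omega>. f (past h k \<omega>) * indicator S (next_step h k \<omega>)) =
      integral\<^sup>L (distr M (count_space UNIV) (\<lambda>\<omega>. (past h k \<omega>, next_step h k \<omega>))) ?g"
    by (simp add: integral_distr[OF m])
  also have "\<dots> = integral\<^sup>L (?D \<Otimes>\<^sub>M measure_pmf ?P) ?g"
    by (simp only: distr_past_next_step[OF h])
  also have "\<dots> = (\<integral>w. (\<integral>v. ?g (w, v) \<partial>measure_pmf ?P) \<partial>?D)"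
    by (rule DP.integral_fst'[OF int, symmetric])
  also have "\<dots> = (\<integral>w. f w * measure_pmf.prob ?P S \<partial>?D)"
  proof -
    have "(\<integral>v. indicator S v \<partial>measure_pmf ?P) = (\<integral>v. complex_of_real (indicator S v) \<partial>measure_pmf ?P)"
      by (rule Bochner_Integration.integral_cong) (simp_all add: indicator_def)
    then have "(\<integral>v. indicator S v \<partial>measure_pmf ?P) = complex_of_real (measure_pmf.prob ?P S)"
      by simp
    then show ?thesis by simp
  qed
  also have "\<dots> = expectation (\<lambda>\<omega>. f (past h k \<omega>)) * measure_pmf.prob ?P S"
    by (simp add: integral_distr[OF measurable_past[OF h]])
  finally show ?thesis .
qed

end

section \<open>The backward equation\<close>

text \<open>The Feynman-Kac generator: the jump generator of the direction index plus the potential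
  \<open>\<i> * v\<close>, which accounts for the growth of the phase. Indices are kept in
  \<open>int\<close> instead of being reduced modulo 4.\<close>

definition generator :: "(int \<Rightarrow> real) \<Rightarrow> real \<Rightarrow> real \<Rightarrow> (int \<Rightarrow> complex) \<Rightarrow> int \<Rightarrow> complex" where
  "generator v lam p f j = (\<i> * v j - lam) * f j + lam * (p * f (j + 1) + (1 - p) * f (j - 1))"

lemma norm_convex_combination_le:
  fixes x y :: complex
  assumes "0 \<le> p" "p \<le> 1" "norm x \<le> C" "norm y \<le> C"
  shows "norm (of_real p * x + (1 - of_real p) * y) \<le> C"
proof -
  have "of_real p * x + (1 - of_real p) * y = p *\<^sub>R x + (1 - p) *\<^sub>R y"
    by (simp add: scaleR_conv_of_real)
  moreover have "p *\<^sub>R x + (1 - p) *\<^sub>R y \<in> cball 0 C"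
    using convexD[OF convex_cball, of x 0 C y p "1 - p"] assms by simp
  ultimately show ?thesis by simp
qed

text \<open>The diagonal part contributes \<open>V + lam\<close> and the turns contribute
  \<open>lam\<close>. Applied twice, the estimate bounds the second time derivative of a solution of
  the backward equation.\<close>

lemma norm_generator_le:
  assumes "\<bar>v j\<bar> \<le> V" "0 \<le> lam" "0 \<le> p" "p \<le> 1" "\<And>j. norm (f j) \<le> C"
  shows "norm (generator v lam p f j) \<le> (V + 2 * lam) * C"
proof -
  have "norm (\<i> * v j - lam) \<le> V + lam"
    using norm_triangle_ineq4[of "\<i> * v j" "of_real lam"] assms by (simp add: norm_mult)
  moreover have "0 \<le> C" using assms(5) order_trans[OF norm_ge_zero] by blast
  ultimately have "norm ((\<i> * v j - lam) * f j) \<le> (V + lam) * C"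
    unfolding norm_mult using assms by (intro mult_mono) auto
  moreover have "norm (lam * (p * f (j + 1) + (1 - p) * f (j - 1))) \<le> lam * C"
    using norm_convex_combination_le[OF assms(3,4) assms(5) assms(5)] assms(2)
    by (simp add: norm_mult mult_left_mono)
  ultimately show ?thesis
    unfolding generator_def by (intro norm_triangle_le) (simp add: algebra_simps)
qed

lemma has_field_derivative_generator:
  assumes "\<And>j. ((\<lambda>w. f w j) has_field_derivative g j) (at w)"
  shows "((\<lambda>w. generator v lam p (f w) j) has_field_derivative generator v lam p g j) (at w)"
  unfolding generator_def by (auto intro!: derivative_eq_intros assms simp: algebra_simps)

text \<open>
  Over a time step \<open>h\<close>, conditioning on at most one turn, which happens at the end of the step,
  reproduces a solution of the backward equation up to an error of order \<open>h\<^sup>2\<close>.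
\<close>

lemma one_turn_approximation:
  fixes s h t lam p :: real and \<phi> :: "complex \<Rightarrow> int \<Rightarrow> complex"
  assumes deriv: "\<And>z j. ((\<lambda>z. \<phi> z j) has_field_derivative generator v lam p (\<phi> z) j) (at z)"
    and bound: "\<And>z j. norm z \<le> t \<Longrightarrow> norm (\<phi> z j) \<le> C"
    and v: "\<And>j. \<bar>v j\<bar> \<le> V"
    and par: "0 \<le> lam" "0 \<le> p" "p \<le> 1"
    and sh: "0 \<le> s" "0 \<le> h" "s + h \<le> t"
  shows "norm (exp (\<i> * of_real (h * v j)) *
      (exp (- (lam * h)) * \<phi> s j + (lam * h * exp (- (lam * h))) * (p * \<phi> s (j + 1) + (1 - p) * \<phi> s (j - 1)))
      - \<phi> (s + h) j) \<le> 3 * exp (lam * t) * (V + 2 * lam)\<^sup>2 * C * h\<^sup>2"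
proof -
  \<comment> \<open>\<open>G\<close> bounds the generator as an operator, and also
    \<open>norm z\<close> and \<open>lam\<close>; hence all error terms below can be given one
    common bound.\<close>
  define G where "G = V + 2 * lam"
  define z where "z = \<i> * v j - lam"
  define e where "e = exp (z * h)"
  define y where "y = p * \<phi> s (j + 1) + (1 - p) * \<phi> s (j - 1)"
  define x where "x = \<phi> s j"
  define E where "E = exp (lam * t)"
  have "0 \<le> V" using v[of 0] by linarith
  then have G: "0 \<le> G" "lam \<le> G" using par by (auto simp: G_def)
  have nx: "norm x \<le> C" and ny: "norm y \<le> C"
    unfolding x_def y_def using bound sh norm_convex_combination_le[OF par(2,3)] by auto
  have C: "0 \<le> C" using nx order_trans[OF norm_ge_zero] by blast
  have nz: "norm (z * h) \<le> G * h"
  proof -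
    have "norm z \<le> V + lam"
      using norm_triangle_ineq4[of "\<i> * v j" "of_real lam"] v[of j] par by (simp add: norm_mult z_def)
    then have "norm z \<le> G" using par by (simp add: G_def)
    then show ?thesis using sh by (simp add: norm_mult mult_right_mono)
  qed
  have Re: "exp \<bar>Re (z * h)\<bar> \<le> E" "1 \<le> E"
    using sh par by (auto simp: z_def E_def abs_mult intro!: mult_left_mono mult_nonneg_nonneg)
  have "norm (e - 1 - z * h) \<le> exp \<bar>Re (z * h)\<bar> * norm (z * h) ^ 2"
    using Taylor_exp[of "z * h" 1] by (simp add: e_def diff_diff_eq power2_eq_square)
  also have "\<dots> \<le> E * (G * h) ^ 2"
    using Re nz by (intro mult_mono power_mono) auto
  finally have e2: "norm (e - 1 - z * h) \<le> E * (G * h) ^ 2" .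
  have "norm (e - 1) \<le> exp \<bar>Re (z * h)\<bar> * norm (z * h)"
    using Taylor_exp[of "z * h" 0] by (simp add: e_def)
  also have "\<dots> \<le> E * (G * h)"
    using Re nz by (intro mult_mono) auto
  finally have e1: "norm (e - 1) \<le> E * (G * h)" .
  \<comment> \<open>The error consists of three terms, whence the factor 3: the second-order
    remainder of \<open>e\<close> in the term without a turn, the replacement of \<open>e\<close> by
    1 in the term with one turn, and the Taylor remainder of \<open>\<phi>\<close>.\<close>
  have "norm ((e - 1 - z * h) * x) \<le> E * (G * h) ^ 2 * C"
    unfolding norm_mult using e2 nx Re by (intro mult_mono) auto
  moreover have "norm (lam * h * y * (e - 1)) \<le> E * (G * h) ^ 2 * C"
  proof -
    have "norm (lam * h * y * (e - 1)) = (lam * h) * norm y * norm (e - 1)"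
      using par sh by (simp add: norm_mult)
    also have "\<dots> \<le> (G * h) * C * (E * (G * h))"
      using par sh G C ny e1 by (intro mult_mono mult_nonneg_nonneg) auto
    finally show ?thesis by (simp add: power2_eq_square mult_ac)
  qed
  moreover have "norm (\<phi> (s + h) j - (\<phi> s j + generator v lam p (\<phi> s) j * h)) \<le> E * (G * h) ^ 2 * C"
  proof -
    \<comment> \<open>\<open>\<phi>\<close> and its first two time derivatives, as the complex
      Taylor formula on the disc \<open>cball 0 t\<close> expects them. The generator is linear and
      does not depend on time, so the second derivative is the generator applied twice.\<close>
    define f where "f i w = (if i = 0 then \<phi> w j else if i = 1 then generator v lam p (\<phi> w) j
      else generator v lam p (generator v lam p (\<phi> w)) j)" for i :: nat and w
    have d2: "((\<lambda>w. generator v lam p (\<phi> w) j) has_field_derivative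
        generator v lam p (generator v lam p (\<phi> w)) j) (at w)" for w
      by (rule has_field_derivative_generator[OF deriv])
    have "norm (f 0 (of_real (s + h)) - (\<Sum>i\<le>1. f i (of_real s) * (of_real (s + h) - of_real s) ^ i / fact i))
        \<le> (G * (G * C)) * norm (of_real (s + h) - of_real s :: complex) ^ Suc 1 / fact 1"
    proof (rule field_Taylor[of "cball 0 t"])
      show "(f i has_field_derivative f (Suc i) w) (at w within cball 0 t)" if "i \<le> 1" for i w
        using that deriv d2 by (cases i) (auto simp: f_def[abs_def] intro: has_field_derivative_at_within)
      show "norm (f (Suc 1) w) \<le> G * (G * C)" if "w \<in> cball 0 t" for w
        using that bound norm_generator_le[OF v par] by (simp add: f_def G_def)
      show "complex_of_real (s + h) \<in> cball 0 t" "complex_of_real s \<in> cball 0 t"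
        using sh by (simp_all add: dist_norm del: of_real_add)
    qed simp
    then have "norm (\<phi> (s + h) j - (\<phi> s j + generator v lam p (\<phi> s) j * h)) \<le> (G * h) ^ 2 * C"
      using sh by (simp add: f_def power2_eq_square mult_ac)
    also have "\<dots> \<le> E * ((G * h) ^ 2 * C)"
      using Re(2) C mult_right_mono[of 1 E "(G * h) ^ 2 * C"] by simp
    finally show ?thesis by (simp add: mult_ac)
  qed
  ultimately have *: "norm ((e - 1 - z * h) * x + lam * h * y * (e - 1)
      - (\<phi> (s + h) j - (\<phi> s j + generator v lam p (\<phi> s) j * h))) \<le> 3 * (E * (G * h) ^ 2 * C)"
    using norm_triangle_ineq4[of "(e - 1 - z * h) * x + lam * h * y * (e - 1)" "\<phi> (s + h) j - (\<phi> s j + generator v lam p (\<phi> s) j * h)"]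
      norm_triangle_ineq[of "(e - 1 - z * h) * x" "lam * h * y * (e - 1)"]
    by linarith
  have gen: "generator v lam p (\<phi> s) j = z * x + lam * y"
    by (simp add: generator_def z_def x_def y_def)
  have "exp (\<i> * of_real (h * v j)) * exp (- (lam * h)) = e"
    by (simp add: e_def z_def exp_of_real[symmetric] exp_add[symmetric] algebra_simps)
  then have "exp (\<i> * of_real (h * v j)) * (exp (- (lam * h)) * x + (lam * h * exp (- (lam * h))) * y)
      = e * x + lam * h * e * y"
    by (auto simp: algebra_simps)
  then have eq: "exp (\<i> * of_real (h * v j)) *
      (exp (- (lam * h)) * x + (lam * h * exp (- (lam * h))) * y) - \<phi> (s + h) j
      = (e - 1 - z * h) * x + lam * h * y * (e - 1) - (\<phi> (s + h) j - (\<phi> s j + generator v lam p (\<phi> s) j * h))"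
    unfolding gen by (simp add: x_def algebra_simps)
  have "norm (exp (\<i> * of_real (h * v j)) *
      (exp (- (lam * h)) * x + (lam * h * exp (- (lam * h))) * y) - \<phi> (s + h) j) \<le> 3 * (E * (G * h) ^ 2 * C)"
    unfolding eq by (rule *)
  also have "\<dots> = 3 * exp (lam * t) * (V + 2 * lam)\<^sup>2 * C * h\<^sup>2"
    by (simp add: E_def G_def power_mult_distrib mult_ac)
  finally show ?thesis unfolding x_def y_def .
qed

text \<open>The values 0 and 1 have total mass \<open>(1 + \<mu>) * exp (- \<mu>)\<close>, which is
  at least \<open>(1 + \<mu>) * (1 - \<mu>)\<close>, that is 1 minus the square of
  \<open>\<mu>\<close>.\<close>

lemma poisson_tail_le: 
  fixes \<mu> :: real
  assumes "0 < \<mu>"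
  shows "measure_pmf.prob (poisson_pmf \<mu>) {2..} \<le> \<mu>\<^sup>2"
proof -
  have "{2..} = UNIV - {0, 1 :: nat}" by auto
  then have "measure_pmf.prob (poisson_pmf \<mu>) {2..} = 1 - measure_pmf.prob (poisson_pmf \<mu>) {0, 1}"
    using measure_pmf.prob_compl[of "{0, 1}" "poisson_pmf \<mu>"] by simp
  also have "measure_pmf.prob (poisson_pmf \<mu>) {0, 1} = (1 + \<mu>) * exp (- \<mu>)"
    using assms by (simp add: measure_measure_pmf_finite algebra_simps)
  also have "1 - (1 + \<mu>) * exp (- \<mu>) \<le> 1 - (1 + \<mu>) * (1 - \<mu>)"
    using assms exp_ge_add_one_self[of "- \<mu>"] by (intro diff_left_mono mult_left_mono) auto
  finally show ?thesis by (simp add: power2_eq_square algebra_simps)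
qed

text \<open>Recovers \<open>index\<close> at the grid time number \<open>i\<close> from the past:
  the first \<open>i\<close> increments tell how many coins have been used by then.\<close>

definition grid_index :: "nat \<Rightarrow> nat list \<times> int \<times> bool list \<Rightarrow> int" where
  "grid_index i = (\<lambda>(ms, j, bs). j + (\<Sum>l<sum_list (take i ms). if bs ! l then 1 else - 1))"

section \<open>The phase factor over one grid step\<close>

context turning_motion
begin

text \<open>The Riemann sum uses left endpoints. Therefore \<open>phase v h (Suc k)\<close> involves
  directions only up to time \<open>real k * h\<close>; it is a function of \<open>past h k\<close>
  and independent of \<open>next_step h k\<close>.\<close>

definition phase :: "(int \<Rightarrow> real) \<Rightarrow> real \<Rightarrow> nat \<Rightarrow> 'a \<Rightarrow> complex" where
  "phase v h k \<omega> = exp (\<i> * of_real (h * (\<Sum>i<k. v (index (real i * h) \<omega>))))"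

lemma index_eq_grid_index:
  assumes h: "0 < h" and \<omega>: "\<omega> \<in> space M" and "i \<le> k"
  shows "index (real i * h) \<omega> = grid_index i (past h k \<omega>)"
proof -
  have "take i (map (\<lambda>i. incr h i \<omega>) [0..<k]) = map (\<lambda>i. incr h i \<omega>) [0..<i]"
    using assms(3) by (simp add: take_map)
  then have 1: "sum_list (take i (map (\<lambda>i. incr h i \<omega>) [0..<k])) = N (real i * h) \<omega>"
    using N_grid[of h \<omega> i] h \<omega> by (simp add: interv_sum_list_conv_sum_set_nat atLeast0LessThan)
  have "N (real i * h) \<omega> \<le> N (real k * h) \<omega>"
    by (rule mono_onD[OF N_mono[OF \<omega>]]) (use h assms(3) in auto)
  then have "(\<Sum>l<N (real i * h) \<omega>. if map (\<lambda>l. \<xi> l \<omega>) [0..<N (real k * h) \<omega>] ! l then 1 else - 1 :: int)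
      = (\<Sum>l<N (real i * h) \<omega>. if \<xi> l \<omega> then 1 else - 1)"
    by (intro sum.cong) auto
  then show ?thesis
    by (simp only: index_def grid_index_def past_def prod.case 1)
qed

lemma phase_eq_past:
  assumes "0 < h" "\<omega> \<in> space M" "l \<le> Suc k"
  shows "phase v h l \<omega> = exp (\<i> * of_real (h * (\<Sum>i<l. v (grid_index i (past h k \<omega>)))))"
proof -
  have "(\<Sum>i<l. v (index (real i * h) \<omega>)) = (\<Sum>i<l. v (grid_index i (past h k \<omega>)))"
    using assms by (intro sum.cong) (auto simp: index_eq_grid_index[of h \<omega> _ k])
  then show ?thesis by (simp only: phase_def)
qed

lemma norm_phase [simp]: "norm (phase v h k \<omega>) = 1"
  by (simp add: phase_def)

lemma phase_Suc: "phase v h (Suc k) \<omega> = phase v h k \<omega> * exp (\<i> * of_real (h * v (index (real k * h) \<omega>)))"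
  by (simp add: phase_def exp_add[symmetric] algebra_simps)

text \<open>The product factors through \<open>past h k\<close>, which takes discrete values, so
  arbitrary functions \<open>v\<close> and \<open>f\<close> are admissible.\<close>

lemma measurable_phase_mult:
  fixes f :: "int \<Rightarrow> complex"
  assumes "0 < h" "l \<le> Suc k"
  shows "(\<lambda>\<omega>. phase v h l \<omega> * f (index (real k * h) \<omega>)) \<in> borel_measurable M"
proof -
  let ?F = "\<lambda>w. exp (\<i> * of_real (h * (\<Sum>i<l. v (grid_index i w)))) * f (grid_index k w)"
  have "(\<lambda>\<omega>. ?F (past h k \<omega>)) \<in> borel_measurable M"
    by (rule measurable_compose[OF measurable_past[OF assms(1)]]) simp
  then show ?thesis
    by (rule measurable_cong[THEN iffD1, rotated])
      (simp only: index_eq_grid_index[OF assms(1) _ order_refl, of _ k] phase_eq_past[OF assms(1) _ assms(2)])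
qed

lemma integrable_phase_mult:
  fixes f :: "int \<Rightarrow> complex"
  assumes "0 < h" "l \<le> Suc k" "\<And>j. norm (f j) \<le> C"
  shows "integrable M (\<lambda>\<omega>. phase v h l \<omega> * f (index (real k * h) \<omega>))"
  by (rule integrable_const_bound[of _ C])
    (use assms measurable_phase_mult in \<open>auto simp: norm_mult\<close>)

lemma expectation_phase_next:
  fixes f :: "int \<Rightarrow> complex"
  assumes h: "0 < h" and bound: "\<And>j. norm (f j) \<le> C"
  shows "expectation (\<lambda>\<omega>. phase v h (Suc k) \<omega> * f (index (real k * h) \<omega>) * indicator S (next_step h k \<omega>)) =
    expectation (\<lambda>\<omega>. phase v h (Suc k) \<omega> * f (index (real k * h) \<omega>)) *
      measure_pmf.prob (pair_pmf (poisson_pmf (rate * h)) (bernoulli_pmf p)) S"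
proof -
  let ?F = "\<lambda>w. exp (\<i> * of_real (h * (\<Sum>i<Suc k. v (grid_index i w)))) * f (grid_index k w)"
  have eq: "phase v h (Suc k) \<omega> * f (index (real k * h) \<omega>) = ?F (past h k \<omega>)" if "\<omega> \<in> space M" for \<omega>
    by (simp only: index_eq_grid_index[OF h that order_refl, of k] phase_eq_past[OF h that order_refl, of v k])
  have "norm (?F w) \<le> C" for w
    using bound by (simp add: norm_mult)
  from expectation_past_next_step[OF h this, where k = k and S = S]
  show ?thesis
    using eq by (simp only: cong: Bochner_Integration.integral_cong)
qed

lemma index_next:
  assumes h: "0 < h" and \<omega>: "\<omega> \<in> space M"
  shows "next_step h k \<omega> = (0, b) \<Longrightarrow> index (real (Suc k) * h) \<omega> = index (real k * h) \<omega>"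
    and "next_step h k \<omega> = (1, True) \<Longrightarrow> index (real (Suc k) * h) \<omega> = index (real k * h) \<omega> + 1"
    and "next_step h k \<omega> = (1, False) \<Longrightarrow> index (real (Suc k) * h) \<omega> = index (real k * h) \<omega> - 1"
proof -
  have N: "N (real (Suc k) * h) \<omega> = N (real k * h) \<omega> + incr h k \<omega>"
    using N_grid[of h \<omega> k] N_grid[of h \<omega> "Suc k"] h \<omega> by simp
  show "next_step h k \<omega> = (0, b) \<Longrightarrow> index (real (Suc k) * h) \<omega> = index (real k * h) \<omega>"
    using N by (simp add: index_def next_step_def)
  show "next_step h k \<omega> = (1, True) \<Longrightarrow> index (real (Suc k) * h) \<omega> = index (real k * h) \<omega> + 1"
    "next_step h k \<omega> = (1, False) \<Longrightarrow> index (real (Suc k) * h) \<omega> = index (real k * h) \<omega> - 1"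
    using N by (auto simp add: index_def next_step_def)
qed

text \<open>With at most one Poisson event in the step, the new index is determined by the old one
  and by \<open>next_step\<close>, which is independent of the past; this produces the Poisson and
  coin weights. Several events occur with probability at most the square of \<open>rate * h\<close>,
  and there \<open>f\<close> is bounded by \<open>C\<close>.\<close>

lemma one_step_expectation:
  fixes f :: "int \<Rightarrow> complex"
  assumes h: "0 < h" and bound: "\<And>j. norm (f j) \<le> C"
  shows "norm (expectation (\<lambda>\<omega>. phase v h (Suc k) \<omega> * f (index (real (Suc k) * h) \<omega>)) -
    expectation (\<lambda>\<omega>. phase v h (Suc k) \<omega> *
      (exp (- (rate * h)) * f (index (real k * h) \<omega>) + (rate * h * exp (- (rate * h))) *
        (p * f (index (real k * h) \<omega> + 1) + (1 - p) * f (index (real k * h) \<omega> - 1))))) \<le> C * (rate * h)\<^sup>2"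
proof -
  let ?\<mu> = "rate * h"
  let ?P = "pair_pmf (poisson_pmf ?\<mu>) (bernoulli_pmf p)"
  let ?I = "index (real k * h)"
  let ?Z = "phase v h (Suc k)"
  let ?Y = "\<lambda>\<omega>. ?Z \<omega> * f (index (real (Suc k) * h) \<omega>)"
  \<comment> \<open>The contribution of the outcomes in \<open>S\<close> if they move the index by
    \<open>d\<close>. Subtracting the contributions of no event and of one event in either direction
    leaves \<open>Rest\<close>, which vanishes unless the step contains at least two events.\<close>
  define X where "X d S \<omega> = ?Z \<omega> * f (?I \<omega> + d) * indicator S (next_step h k \<omega>)" for d S \<omega>
  define Rest where "Rest \<omega> = ?Y \<omega> - X 0 ({0} \<times> UNIV) \<omega> - X 1 {(1, True)} \<omega> - X (-1) {(1, False)} \<omega>" for \<omega>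
  have \<mu>: "0 < ?\<mu>" using rate_pos h by simp
  have C: "0 \<le> C" using bound order_trans[OF norm_ge_zero] by blast
  have [measurable]: "(\<lambda>\<omega>. g (next_step h k \<omega>)) \<in> borel_measurable M" for g :: "_ \<Rightarrow> complex"
    by (rule measurable_compose[OF measurable_next_step[OF h]]) simp
  have intX: "integrable M (X d S)" for d S
  proof (rule integrable_const_bound[of _ C])
    have [measurable]: "(\<lambda>\<omega>. ?Z \<omega> * f (?I \<omega> + d)) \<in> borel_measurable M"
      using measurable_phase_mult[of h "Suc k" k v "\<lambda>j. f (j + d)"] h by simp
    show "X d S \<in> borel_measurable M" unfolding X_def[abs_def] by measurable
    show "AE \<omega> in M. norm (X d S \<omega>) \<le> C"
      using C bound by (auto simp: X_def norm_mult indicator_def)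
  qed
  have intY: "integrable M ?Y"
    using integrable_phase_mult[of h "Suc k" "Suc k" f C v] h bound by simp
  have intI: "integrable M (\<lambda>\<omega>. ?Z \<omega> * f (?I \<omega> + d))" for d
    using integrable_phase_mult[of h "Suc k" k "\<lambda>j. f (j + d)" C v] h bound by simp
  have EX: "expectation (X d S) = expectation (\<lambda>\<omega>. ?Z \<omega> * f (?I \<omega> + d)) * measure_pmf.prob ?P S" for d S
    using expectation_phase_next[of h "\<lambda>j. f (j + d)" C v k S] h bound by (simp add: X_def[abs_def])
  have P: "measure_pmf.prob ?P ({0} \<times> UNIV) = exp (- ?\<mu>)"
    "measure_pmf.prob ?P {(1, True)} = ?\<mu> * exp (- ?\<mu>) * p"
    "measure_pmf.prob ?P {(1, False)} = ?\<mu> * exp (- ?\<mu>) * (1 - p)"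
    using \<mu> p_nonneg p_le_1
    by (simp_all add: measure_pmf_prob_product measure_pmf_single pmf_pair)
  have main: "expectation (X 0 ({0} \<times> UNIV)) + expectation (X 1 {(1, True)}) + expectation (X (-1) {(1, False)}) =
    expectation (\<lambda>\<omega>. ?Z \<omega> * (exp (- ?\<mu>) * f (?I \<omega>) + (?\<mu> * exp (- ?\<mu>)) *
        (p * f (?I \<omega> + 1) + (1 - p) * f (?I \<omega> - 1))))"
  proof -
    have "(\<lambda>\<omega>. ?Z \<omega> * (exp (- ?\<mu>) * f (?I \<omega>) + (?\<mu> * exp (- ?\<mu>)) *
        (p * f (?I \<omega> + 1) + (1 - p) * f (?I \<omega> - 1)))) =
      (\<lambda>\<omega>. ?Z \<omega> * f (?I \<omega> + 0) * of_real (exp (- ?\<mu>)) + ?Z \<omega> * f (?I \<omega> + 1) * of_real (?\<mu> * exp (- ?\<mu>) * p) +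
        ?Z \<omega> * f (?I \<omega> + -1) * of_real (?\<mu> * exp (- ?\<mu>) * (1 - p)))"
      by (simp add: fun_eq_iff algebra_simps)
    then show ?thesis
      unfolding EX P using intI
      by (simp only: Bochner_Integration.integral_add integrable_mult_left integral_mult_left_zero
          Bochner_Integration.integrable_add)
  qed
  have Rest: "norm (Rest \<omega>) \<le> C * indicator {2..} (incr h k \<omega>)" if "\<omega> \<in> space M" for \<omega>
  proof -
    obtain a b where ab: "next_step h k \<omega> = (a, b)" by (cases "next_step h k \<omega>")
    then have a: "incr h k \<omega> = a" by (simp add: next_step_def)
    consider "a = 0" | "a = 1" "b" | "a = 1" "\<not> b" | "a \<ge> 2" by linarith
    then show ?thesis
    proof cases
      case 1
      then show ?thesis using ab a index_next(1)[OF h that, of k b] C by (simp add: Rest_def X_def)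
    next
      case 2
      then show ?thesis using ab a index_next(2)[OF h that, of k] C by (simp add: Rest_def X_def)
    next
      case 3
      then show ?thesis using ab a index_next(3)[OF h that, of k] C by (simp add: Rest_def X_def)
    next
      case 4
      then show ?thesis using ab a bound by (simp add: Rest_def X_def norm_mult)
    qed
  qed
  have "expectation ?Y - expectation (\<lambda>\<omega>. ?Z \<omega> * (exp (- ?\<mu>) * f (?I \<omega>) + (?\<mu> * exp (- ?\<mu>)) *
        (p * f (?I \<omega> + 1) + (1 - p) * f (?I \<omega> - 1)))) = expectation Rest"
    unfolding main[symmetric] Rest_def[abs_def] using intX intY
    by (simp add: algebra_simps)
  also have "norm \<dots> \<le> expectation (\<lambda>\<omega>. C * indicator {2..} (incr h k \<omega>))"
  proof (rule order_trans[OF integral_norm_bound integral_mono])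
    show "integrable M (\<lambda>\<omega>. norm (Rest \<omega>))"
      unfolding Rest_def[abs_def] using intX intY by (intro integrable_norm) simp
    have "(\<lambda>\<omega>. C * indicator {2..} (incr h k \<omega>)) \<in> borel_measurable M"
      by (rule measurable_compose[OF measurable_incr[OF h]]) simp
    then show "integrable M (\<lambda>\<omega>. C * indicator {2..} (incr h k \<omega>))"
      by (rule integrable_const_bound[of _ C, rotated]) (use C in \<open>auto simp: indicator_def\<close>)
  qed (use Rest in auto)
  also have "\<dots> = C * measure (distr M (count_space UNIV) (incr h k)) {2..}"
  proof -
    have "expectation (\<lambda>\<omega>. C * indicator {2..} (incr h k \<omega>)) =
        (\<integral>a. C * indicator {2..} a \<partial>distr M (count_space UNIV) (incr h k))"
      by (rule integral_distr[OF measurable_incr[OF h], symmetric]) simp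
    then show ?thesis by simp
  qed
  also have "distr M (count_space UNIV) (incr h k) = measure_pmf (poisson_pmf ?\<mu>)"
    using N_increments_poisson[of "real k * h" "real (Suc k) * h"] h
    by (simp add: incr_def[abs_def] algebra_simps)
  also have "C * measure_pmf.prob (poisson_pmf ?\<mu>) {2..} \<le> C * ?\<mu>\<^sup>2"
    using poisson_tail_le[OF \<mu>] C by (intro mult_left_mono) auto
  finally show ?thesis .
qed

end

section \<open>Summation of the one-step errors\<close>

context turning_motion
begin

text \<open>With exact steps the first expectation would not depend on \<open>k\<close>: what the
  phase gains, \<open>\<phi>\<close> loses through its shorter remaining time. Each actual step adds
  the error of \<open>one_step_expectation\<close>, from several events, and that of
  \<open>one_turn_approximation\<close>, from the backward equation.\<close>

lemma grid_expectation_error: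
  fixes \<phi> :: "complex \<Rightarrow> int \<Rightarrow> complex"
  assumes deriv: "\<And>z j. ((\<lambda>z. \<phi> z j) has_field_derivative generator v rate p (\<phi> z) j) (at z)"
    and bound: "\<And>z j. norm z \<le> t \<Longrightarrow> norm (\<phi> z j) \<le> C"
    and initial: "\<And>j. \<phi> 0 j = 1"
    and v: "\<And>j. \<bar>v j\<bar> \<le> V"
    and h: "0 < h" and k: "real k * h \<le> t"
  shows "norm (expectation (\<lambda>\<omega>. phase v h k \<omega> * \<phi> (of_real (t - real k * h)) (index (real k * h) \<omega>)) -
      expectation (\<lambda>\<omega>. \<phi> (of_real t) (J \<omega>)))
    \<le> real k * ((3 * exp (rate * t) * (V + 2 * rate)\<^sup>2 + rate\<^sup>2) * C * h\<^sup>2)"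
  using k
proof (induction k)
  case 0
  have "expectation (\<lambda>\<omega>. phase v h 0 \<omega> * \<phi> (of_real t) (index 0 \<omega>)) =
      expectation (\<lambda>\<omega>. \<phi> (of_real t) (J \<omega>))"
    by (rule Bochner_Integration.integral_cong) (auto simp: phase_def index_def N_0)
  then show ?case by simp
next
  case (Suc k)
  let ?B = "3 * exp (rate * t) * (V + 2 * rate)\<^sup>2 * C * h\<^sup>2"
  let ?I = "index (real k * h)"
  define s where "s = t - real (Suc k) * h"
  have s: "0 \<le> s" "s + h \<le> t" and sh: "t - real k * h = s + h"
    using Suc.prems h by (auto simp: s_def algebra_simps)
  have "0 \<le> t" using s h by linarith
  have bs: "norm (\<phi> (of_real s) j) \<le> C" "norm (\<phi> (of_real (s + h)) j) \<le> C" for j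
    using bound s h by (simp_all del: of_real_add)
  \<comment> \<open>The one-turn approximation together with the phase gained during the step;
    \<open>phase_Suc\<close> moves that phase factor from \<open>phase v h (Suc k)\<close> into
    \<open>g\<close>.\<close>
  define g where "g j = exp (\<i> * of_real (h * v j)) * (exp (- (rate * h)) * \<phi> s j +
      (rate * h * exp (- (rate * h))) * (p * \<phi> s (j + 1) + (1 - p) * \<phi> s (j - 1)))" for j
  have gB: "norm (g j - \<phi> (of_real (s + h)) j) \<le> ?B" for j
    unfolding g_def
    by (rule one_turn_approximation[OF deriv bound v])
      (use rate_pos p_nonneg p_le_1 s h in auto)
  have gC: "norm (g j) \<le> ?B + C" for j
    using gB[of j] bs(2)[of j] norm_triangle_sub[of "g j" "\<phi> (of_real (s + h)) j"] by linarith
  have "(\<lambda>\<omega>. phase v h (Suc k) \<omega> * (exp (- (rate * h)) * \<phi> s (?I \<omega>) +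
      (rate * h * exp (- (rate * h))) * (p * \<phi> s (?I \<omega> + 1) + (1 - p) * \<phi> s (?I \<omega> - 1))))
    = (\<lambda>\<omega>. phase v h k \<omega> * g (?I \<omega>))"
    by (simp add: phase_Suc g_def mult.assoc)
  with one_step_expectation[where f = "\<phi> (of_real s)" and v = v and k = k, OF h bs(1)]
  have 1: "norm (expectation (\<lambda>\<omega>. phase v h (Suc k) \<omega> * \<phi> (of_real s) (index (real (Suc k) * h) \<omega>)) -
      expectation (\<lambda>\<omega>. phase v h k \<omega> * g (?I \<omega>))) \<le> C * (rate * h)\<^sup>2"
    by (simp only:)
  have split: "expectation (\<lambda>\<omega>. phase v h k \<omega> * g (?I \<omega>)) - expectation (\<lambda>\<omega>. phase v h k \<omega> * \<phi> (of_real (s + h)) (?I \<omega>))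
      = expectation (\<lambda>\<omega>. phase v h k \<omega> * (g (?I \<omega>) - \<phi> (of_real (s + h)) (?I \<omega>)))"
    by (subst Bochner_Integration.integral_diff[symmetric])
      (use integrable_phase_mult[OF h _ gC, of k k v] integrable_phase_mult[OF h _ bs(2), of k k v]
        in \<open>auto simp: algebra_simps\<close>)
  have "norm (expectation (\<lambda>\<omega>. phase v h k \<omega> * (g (?I \<omega>) - \<phi> (of_real (s + h)) (?I \<omega>))))
      \<le> expectation (\<lambda>\<omega>. ?B)"
  proof (rule order_trans[OF integral_norm_bound integral_mono])
    show "integrable M (\<lambda>\<omega>. norm (phase v h k \<omega> * (g (?I \<omega>) - \<phi> (of_real (s + h)) (?I \<omega>))))"
      by (rule integrable_norm[OF integrable_phase_mult[OF h _ gB]]) simp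
  qed (use gB in \<open>auto simp: norm_mult\<close>)
  then have 2: "norm (expectation (\<lambda>\<omega>. phase v h k \<omega> * g (?I \<omega>)) -
      expectation (\<lambda>\<omega>. phase v h k \<omega> * \<phi> (of_real (s + h)) (?I \<omega>))) \<le> ?B"
    unfolding split by (simp add: prob_space)
  have "real k * h \<le> t" using s h sh by linarith
  from Suc.IH[OF this] have 3: "norm (expectation (\<lambda>\<omega>. phase v h k \<omega> * \<phi> (of_real (s + h)) (?I \<omega>)) -
      expectation (\<lambda>\<omega>. \<phi> (of_real t) (J \<omega>)))
    \<le> real k * ((3 * exp (rate * t) * (V + 2 * rate)\<^sup>2 + rate\<^sup>2) * C * h\<^sup>2)"
    unfolding sh .
  have tri: "norm (a - d) \<le> norm (a - b) + norm (b - c) + norm (c - d)" for a b c d :: complex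
    using norm_triangle_ineq[of "a - b" "b - c"] norm_triangle_ineq[of "a - c" "c - d"] by simp
  show ?case
    unfolding s_def[symmetric]
    by (rule order_trans[OF tri order_trans[OF add_mono[OF add_mono[OF 1 2] 3]]])
      (simp add: algebra_simps power_mult_distrib)
qed

text \<open>After \<open>Suc n\<close> steps of length \<open>t / real (Suc n)\<close> no time
  remains and \<open>\<phi> 0 j = 1\<close> leaves the phase alone. The accumulated error is a
  constant divided by \<open>Suc n\<close>.\<close>

lemma tendsto_expectation_phase:
  fixes \<phi> :: "complex \<Rightarrow> int \<Rightarrow> complex"
  assumes deriv: "\<And>z j. ((\<lambda>z. \<phi> z j) has_field_derivative generator v rate p (\<phi> z) j) (at z)"
    and bound: "\<And>z j. norm z \<le> t \<Longrightarrow> norm (\<phi> z j) \<le> C"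
    and initial: "\<And>j. \<phi> 0 j = 1"
    and v: "\<And>j. \<bar>v j\<bar> \<le> V"
    and t: "0 < t"
  shows "(\<lambda>n. expectation (\<lambda>\<omega>. phase v (t / real (Suc n)) (Suc n) \<omega>))
    \<longlonglongrightarrow> expectation (\<lambda>\<omega>. \<phi> (of_real t) (J \<omega>))"
proof (rule LIM_zero_cancel, rule Lim_null_comparison)
  let ?K = "(3 * exp (rate * t) * (V + 2 * rate)\<^sup>2 + rate\<^sup>2) * C"
  show "\<forall>\<^sub>F n in sequentially. norm (expectation (\<lambda>\<omega>. phase v (t / real (Suc n)) (Suc n) \<omega>) -
      expectation (\<lambda>\<omega>. \<phi> (of_real t) (J \<omega>))) \<le> ?K * t\<^sup>2 * inverse (real (Suc n))"
  proof (rule always_eventually, rule allI)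
    fix n
    let ?h = "t / real (Suc n)"
    have "real (Suc n) * ?h = t" by simp
    then have "norm (expectation (\<lambda>\<omega>. phase v ?h (Suc n) \<omega>) - expectation (\<lambda>\<omega>. \<phi> (of_real t) (J \<omega>)))
        \<le> real (Suc n) * (?K * ?h\<^sup>2)"
      using grid_expectation_error[OF deriv bound initial v, of t ?h "Suc n"] t initial by simp
    also have "\<dots> = ?K * t\<^sup>2 * inverse (real (Suc n))"
      by (simp add: power2_eq_square divide_simps del: of_nat_Suc)
    finally show "norm (expectation (\<lambda>\<omega>. phase v ?h (Suc n) \<omega>) - expectation (\<lambda>\<omega>. \<phi> (of_real t) (J \<omega>)))
        \<le> ?K * t\<^sup>2 * inverse (real (Suc n))" .
  qed
  show "(\<lambda>n. ?K * t\<^sup>2 * inverse (real (Suc n))) \<longlonglongrightarrow> 0"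
    by (rule tendsto_mult_right_zero[OF LIMSEQ_inverse_real_of_nat])
qed

end

section \<open>Riemann sums along a counting path\<close>

text \<open>Telescoping over the levels below \<open>N t\<close> writes the function on
  \<open>{0..t}\<close> as a finite combination of the monotone indicators of
  \<open>m < N \<tau>\<close>.\<close>

lemma integrable_on_comp_mono_nat:
  fixes N :: "real \<Rightarrow> nat" and F :: "nat \<Rightarrow> 'b::euclidean_space"
  assumes "mono_on {0..} N"
  shows "(\<lambda>\<tau>. F (N \<tau>)) integrable_on {0..t}"
proof -
  have "mono_on {0..t} (\<lambda>\<tau>. of_bool (m < N \<tau>) :: real)" for m
    by (rule mono_onI) (use mono_onD[OF assms] in \<open>force simp: of_bool_def\<close>)
  then have 1: "(\<lambda>\<tau>. of_bool (m < N \<tau>) :: real) integrable_on {0..t}" for m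
    by (rule integrable_on_mono_on)
  have "(\<lambda>\<tau>. F 0 + (\<Sum>m<N t. of_bool (m < N \<tau>) *\<^sub>R (F (Suc m) - F m))) integrable_on {0..t}"
    by (intro integrable_add integrable_sum integrable_const_ivl finite_lessThan)
      (rule integrable_on_scaleR_left[OF 1])
  then show ?thesis
  proof (rule integrable_eq)
    fix \<tau> assume "\<tau> \<in> {0..t}"
    then have "N \<tau> \<le> N t" by (intro mono_onD[OF assms]) auto
    then have "(\<Sum>m<N t. of_bool (m < N \<tau>) *\<^sub>R (F (Suc m) - F m)) = (\<Sum>m<N \<tau>. F (Suc m) - F m)"
      by (intro sum.mono_neutral_cong_right) auto
    then show "F 0 + (\<Sum>m<N t. of_bool (m < N \<tau>) *\<^sub>R (F (Suc m) - F m)) = F (N \<tau>)"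
      by (simp add: sum_lessThan_telescope)
  qed
qed

text \<open>
  The Riemann sum is exact on every grid interval without a jump, and at most \<open>N (n h) - N 0\<close>
  grid intervals contain one.
\<close>

lemma riemann_sum_error:
  fixes N :: "real \<Rightarrow> nat" and F :: "nat \<Rightarrow> 'b::euclidean_space"
  assumes mono: "mono_on {0..} N" and bound: "\<And>m. norm (F m) \<le> C" and h: "0 \<le> h"
  shows "norm (integral {0..real n * h} (\<lambda>\<tau>. F (N \<tau>)) - h *\<^sub>R (\<Sum>i<n. F (N (real i * h))))
    \<le> 2 * C * h * (real (N (real n * h)) - real (N 0))"
proof (induction n)
  case 0
  then show ?case by simp
next
  case (Suc n)
  let ?a = "real n * h" and ?b = "real (Suc n) * h" and ?f = "\<lambda>\<tau>. F (N \<tau>)"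
  have ab: "0 \<le> ?a" "?a \<le> ?b" "?b - ?a = h" using h by (simp_all add: algebra_simps)
  have C: "0 \<le> C" using bound order_trans[OF norm_ge_zero] by blast
  have int: "?f integrable_on {0..?b}"
    by (rule integrable_on_comp_mono_nat[OF mono])
  then have int': "?f integrable_on {?a..?b}"
    by (rule integrable_subinterval_real) (use ab in auto)
  have "integral {0..?b} ?f = integral {0..?a} ?f + integral {?a..?b} ?f"
    using Henstock_Kurzweil_Integration.integral_combine[OF ab(1,2) int] by simp
  then have eq: "integral {0..?b} ?f - h *\<^sub>R (\<Sum>i<Suc n. F (N (real i * h))) =
      (integral {0..?a} ?f - h *\<^sub>R (\<Sum>i<n. F (N (real i * h)))) + (integral {?a..?b} ?f - h *\<^sub>R ?f ?a)"
    by (simp add: algebra_simps)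
  have "norm (integral {?a..?b} ?f - h *\<^sub>R ?f ?a) \<le> 2 * C * h * (real (N ?b) - real (N ?a))"
  proof (cases "N ?a = N ?b")
    case True
    have "integral {?a..?b} ?f = integral {?a..?b} (\<lambda>_. ?f ?a)"
    proof (rule Henstock_Kurzweil_Integration.integral_cong)
      fix \<tau> assume "\<tau> \<in> {?a..?b}"
      then have \<tau>: "?a \<le> \<tau>" "\<tau> \<le> ?b" by auto
      then have "0 \<le> \<tau>" "0 \<le> ?b" using ab(1) by linarith+
      then have "N ?a \<le> N \<tau>" "N \<tau> \<le> N ?b"
        using ab(1) \<tau> by (auto intro!: mono_onD[OF mono] simp del: of_nat_Suc)
      then show "?f \<tau> = ?f ?a" using True by simp
    qed
    then show ?thesis using ab True by simp
  next
    case False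
    moreover have "N ?a \<le> N ?b" using ab by (intro mono_onD[OF mono]) auto
    ultimately have "1 \<le> real (N ?b) - real (N ?a)" by linarith
    \<comment> \<open>On an interval with a jump the integral and its approximation are each bounded
      by \<open>C * h\<close>, whence the factor 2; the increase of the count, at least 1, pays for
      this.\<close>
    have "norm (integral {?a..?b} ?f) \<le> C * (?b - ?a)"
      using has_integral_bound_real[OF C finite.emptyI integrable_integral[OF int']] ab bound
      by (simp del: of_nat_Suc)
    moreover have "norm (h *\<^sub>R ?f ?a) \<le> C * h"
      using mult_right_mono[OF bound[of "N ?a"] h] h by (simp add: mult_ac)
    ultimately have "norm (integral {?a..?b} ?f - h *\<^sub>R ?f ?a) \<le> 2 * C * h * 1"
      using norm_triangle_ineq4[of "integral {?a..?b} ?f" "h *\<^sub>R ?f ?a"] ab by simp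
    also have "\<dots> \<le> 2 * C * h * (real (N ?b) - real (N ?a))"
      using \<open>1 \<le> _\<close> C h by (intro mult_left_mono) auto
    finally show ?thesis .
  qed
  then show ?case
    unfolding eq using Suc.IH by (intro norm_triangle_le) (simp add: algebra_simps)
qed

lemma tendsto_riemann_sum:
  fixes N :: "real \<Rightarrow> nat" and F :: "nat \<Rightarrow> 'b::euclidean_space"
  assumes mono: "mono_on {0..} N" and bound: "\<And>m. norm (F m) \<le> C" and t: "0 \<le> t"
  shows "(\<lambda>n. (t / real (Suc n)) *\<^sub>R (\<Sum>i<Suc n. F (N (real i * (t / real (Suc n))))))
    \<longlonglongrightarrow> integral {0..t} (\<lambda>\<tau>. F (N \<tau>))"
proof (rule Lim_transform[OF tendsto_const], rule Lim_null_comparison)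
  let ?I = "integral {0..t} (\<lambda>\<tau>. F (N \<tau>))"
  let ?S = "\<lambda>n. (t / real (Suc n)) *\<^sub>R (\<Sum>i<Suc n. F (N (real i * (t / real (Suc n)))))"
  let ?K = "2 * C * t * (real (N t) - real (N 0))"
  show "\<forall>\<^sub>F n in sequentially. norm (?S n - ?I) \<le> ?K * inverse (real (Suc n))"
  proof (rule always_eventually, rule allI)
    fix n
    have "real (Suc n) * (t / real (Suc n)) = t" by simp
    then have "norm (?I - ?S n) \<le> 2 * C * (t / real (Suc n)) * (real (N t) - real (N 0))"
      using riemann_sum_error[OF mono bound, of "t / real (Suc n)" "Suc n"] t by simp
    then show "norm (?S n - ?I) \<le> ?K * inverse (real (Suc n))"
      by (simp add: divide_inverse norm_minus_commute algebra_simps)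
  qed
  show "(\<lambda>n. ?K * inverse (real (Suc n))) \<longlonglongrightarrow> 0"
    by (rule tendsto_mult_right_zero[OF LIMSEQ_inverse_real_of_nat])
qed

section \<open>Explicit solution of the backward equation\<close>

text \<open>The rate at which the angle \<alpha> X + \<beta> Y grows in direction
  \<open>dir j\<close>, once \<open>a\<close> is c \<alpha> and \<open>b\<close> is c
  \<beta>.\<close>

definition velocity :: "real \<Rightarrow> real \<Rightarrow> int \<Rightarrow> real" where
  "velocity a b j = (a, b) \<bullet> dir j"

lemma dir_add_1: "dir (j + 1) = (- snd (dir j), fst (dir j))"
proof -
  have "pi * of_int (j + 1) / 2 = pi * of_int j / 2 + pi / 2" by (simp add: field_simps)
  then show ?thesis unfolding dir_def by (simp only: cos_add sin_add) simp
qed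

text \<open>Two quarter turns reverse the direction. The velocities at \<open>j\<close> and
  \<open>j + 1\<close> therefore determine all others, which allows \<open>iterate\<close> to work
  with two arguments.\<close>

lemma velocity_add_2: "velocity a b (j + 1 + 1) = - velocity a b j"
  unfolding velocity_def dir_add_1 by (cases "dir j") simp

lemma velocity_diff_1: "velocity a b (j - 1) = - velocity a b (j + 1)"
  using velocity_add_2[of a b "j - 1"] by simp

lemma dir_cases: "dir j \<in> {(1, 0), (0, 1), (-1, 0), (0, -1)}"
proof (induction j rule: int_induct[of _ 0])
  case base
  show ?case by (simp add: dir_def)
next
  case (step1 j)
  then show ?case by (auto simp: dir_add_1)
next
  case (step2 j)
  have "dir j = (- snd (dir (j - 1)), fst (dir (j - 1)))"
    using dir_add_1[of "j - 1"] by simp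
  then have "dir (j - 1) = (snd (dir j), - fst (dir j))" by (simp add: prod_eq_iff)
  then show ?case using step2 by auto
qed

lemma norm_dir: "norm (dir j) = 1"
  using dir_cases[of j] by (auto simp: norm_prod_def)

text \<open>These symmetric expressions are the same for every \<open>j\<close>, so the recurrence
  for the fourth iterate has coefficients common to all directions.\<close>

lemma velocity_squares:
  "(velocity a b j)\<^sup>2 + (velocity a b (j + 1))\<^sup>2 = a\<^sup>2 + b\<^sup>2"
  "(velocity a b j)\<^sup>2 * (velocity a b (j + 1))\<^sup>2 = a\<^sup>2 * b\<^sup>2"
  using dir_cases[of j] by (auto simp: velocity_def dir_add_1)

text \<open>
  With \<open>x\<close> and \<open>y\<close> the velocities in the current and in the next direction, \<open>iterate n\<close> is the
  \<open>n\<close>-th iterate of \<open>generator v lam p + lam\<close> on the constant 1; the fourth iterate is a combination of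
  the lower ones by the theorem of Cayley and Hamilton.
\<close>

fun iterate :: "real \<Rightarrow> real \<Rightarrow> nat \<Rightarrow> complex \<Rightarrow> complex \<Rightarrow> complex" where
  "iterate lam p 0 x y = 1"
| "iterate lam p (Suc n) x y = \<i> * x * iterate lam p n x y +
     lam * (p * iterate lam p n y (- x) + (1 - p) * iterate lam p n (- y) x)"

lemma iterate_1: "iterate lam p 1 x y = \<i> * x + lam"
  by (simp add: algebra_simps)

lemma iterate_2:
  "iterate lam p 2 x y = - x\<^sup>2 + \<i> * lam * x + lam\<^sup>2 + \<i> * lam * (2 * p - 1) * y"
proof -
  have i: "\<i> * \<i> = (-1 :: complex)" by simp
  have "iterate lam p 2 x y = \<i> * x * iterate lam p 1 x y +
     lam * (p * iterate lam p 1 y (- x) + (1 - p) * iterate lam p 1 (- y) x)"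
    by (simp add: numeral_2_eq_2)
  then show ?thesis unfolding iterate_1 of_real_add of_real_diff of_real_mult of_real_1 of_real_power of_real_numeral
    using i by algebra
qed

lemma iterate_3:
  "iterate lam p 3 x y = - \<i> * x ^ 3 - lam * x\<^sup>2 + \<i> * lam\<^sup>2 * x - lam * (2 * p - 1) * x * y
    - lam * y\<^sup>2 + lam ^ 3 + \<i> * lam\<^sup>2 * (2 * p - 1) * y - \<i> * lam\<^sup>2 * (2 * p - 1)\<^sup>2 * x"
proof -
  have i: "\<i> * \<i> = (-1 :: complex)" by simp
  have "iterate lam p 3 x y = \<i> * x * iterate lam p 2 x y +
     lam * (p * iterate lam p 2 y (- x) + (1 - p) * iterate lam p 2 (- y) x)"
    by (simp add: numeral_3_eq_3 numeral_2_eq_2)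
  then show ?thesis unfolding iterate_2 of_real_add of_real_diff of_real_mult of_real_1 of_real_power of_real_numeral
    using i by algebra
qed

text \<open>The characteristic polynomial of the shifted generator is even, so only the iterates
  number 2 and 0 enter. The identity is verified by expansion, with
  \<open>\<i> * \<i> = -1\<close>.\<close>

lemma iterate_4:
  "iterate lam p 4 x y = - (x\<^sup>2 + y\<^sup>2 - lam\<^sup>2 * (1 - (2 * p - 1)\<^sup>2)) * iterate lam p 2 x y
    - (x\<^sup>2 * y\<^sup>2 - lam ^ 4 * (2 * p - 1)\<^sup>2)"
proof -
  have i: "\<i> * \<i> = (-1 :: complex)" by simp
  have "iterate lam p 4 x y = \<i> * x * iterate lam p 3 x y +
     lam * (p * iterate lam p 3 y (- x) + (1 - p) * iterate lam p 3 (- y) x)"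
    by (simp add: numeral_eq_Suc)
  then show ?thesis unfolding iterate_2 iterate_3 of_real_add of_real_diff of_real_mult of_real_1 of_real_power of_real_numeral
    using i by algebra
qed

section \<open>Solution by hyperbolic functions\<close>

context
  fixes K L :: complex and a b lam p :: real
begin

text \<open>\<open>coeff_0\<close> to \<open>coeff_3\<close> are the coefficients of the cubic
  polynomial in \<mu> that interpolates \<open>exp (\<mu> * z)\<close> at the four roots K, -K, L,
  -L of the characteristic polynomial. They express the exponential of the shifted generator through
  its powers 0 to 3.\<close>

definition coeff_0 :: "complex \<Rightarrow> complex" where
  "coeff_0 z = (K\<^sup>2 * cosh (L * z) - L\<^sup>2 * cosh (K * z)) / (K\<^sup>2 - L\<^sup>2)"

definition coeff_1 :: "complex \<Rightarrow> complex" where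
  "coeff_1 z = (K\<^sup>2 * (sinh (L * z) / L) - L\<^sup>2 * (sinh (K * z) / K)) / (K\<^sup>2 - L\<^sup>2)"

definition coeff_2 :: "complex \<Rightarrow> complex" where
  "coeff_2 z = (cosh (K * z) - cosh (L * z)) / (K\<^sup>2 - L\<^sup>2)"

definition coeff_3 :: "complex \<Rightarrow> complex" where
  "coeff_3 z = (sinh (K * z) / K - sinh (L * z) / L) / (K\<^sup>2 - L\<^sup>2)"

text \<open>The exponential of \<open>z\<close> times the generator, applied to the constant 1; the
  factor \<open>exp (- (of_real lam * z))\<close> undoes the shift by \<open>lam\<close> built into
  \<open>iterate\<close>.\<close>

definition solution :: "complex \<Rightarrow> int \<Rightarrow> complex" where
  "solution z j = exp (- (of_real lam * z)) *
    (coeff_0 z * iterate lam p 0 (velocity a b j) (velocity a b (j + 1)) +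
     coeff_1 z * iterate lam p 1 (velocity a b j) (velocity a b (j + 1)) +
     coeff_2 z * iterate lam p 2 (velocity a b j) (velocity a b (j + 1)) +
     coeff_3 z * iterate lam p 3 (velocity a b j) (velocity a b (j + 1)))"

text \<open>The assumptions \<open>sum\<close> and \<open>prod\<close> identify the squares of
  \<open>K\<close> and \<open>L\<close> with the roots of the characteristic polynomial in the
  square of \<mu>. The derivatives of the coefficients form its companion system, so differentiating
  the combination of iterates raises each iterate by one, the fourth being eliminated by
  \<open>w4\<close>.\<close>

lemma cosh_sinh_solution:
  assumes KL: "K\<^sup>2 \<noteq> L\<^sup>2" "K \<noteq> 0" "L \<noteq> 0"
    and sum: "K\<^sup>2 + L\<^sup>2 = of_real (lam\<^sup>2 * (1 - (2 * p - 1)\<^sup>2) - (a\<^sup>2 + b\<^sup>2))"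
    and prod: "K\<^sup>2 * L\<^sup>2 = of_real (a\<^sup>2 * b\<^sup>2 - lam ^ 4 * (2 * p - 1)\<^sup>2)"
  shows
      "\<And>z j. ((\<lambda>z. solution z j) has_field_derivative generator (velocity a b) lam p (solution z) j) (at z)"
    and "\<And>j. solution 0 j = 1"
    and "\<And>t. \<exists>C. \<forall>z j. norm z \<le> t \<longrightarrow> norm (solution z j) \<le> C"
    and "\<And>z. (solution z 0 + solution z 1 + solution z 2 + solution z 3) / 4 =
      exp (- (of_real lam * z)) * (coeff_0 z + lam * coeff_1 z + (lam\<^sup>2 - (a\<^sup>2 + b\<^sup>2) / 2) * coeff_2 z +
        (lam ^ 3 - lam * (a\<^sup>2 + b\<^sup>2)) * coeff_3 z)"
proof -
  let ?w = "\<lambda>n j. iterate lam p n (velocity a b j) (velocity a b (j + 1))"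
  have nz: "K\<^sup>2 - L\<^sup>2 \<noteq> 0" using KL by simp
  have d0: "(coeff_0 has_field_derivative - (K\<^sup>2 * L\<^sup>2) * coeff_3 z) (at z)" for z
    unfolding coeff_0_def[abs_def] coeff_3_def[abs_def] using KL nz
    by (auto intro!: derivative_eq_intros simp: divide_simps) (auto simp: algebra_simps power2_eq_square)
  have d1: "(coeff_1 has_field_derivative coeff_0 z) (at z)" for z
    unfolding coeff_0_def[abs_def] coeff_1_def[abs_def] using KL nz
    by (auto intro!: derivative_eq_intros simp: divide_simps) (simp add: algebra_simps)
  have d2: "(coeff_2 has_field_derivative coeff_1 z + (K\<^sup>2 + L\<^sup>2) * coeff_3 z) (at z)" for z
    unfolding coeff_1_def[abs_def] coeff_2_def[abs_def] coeff_3_def[abs_def] using KL nz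
    by (auto intro!: derivative_eq_intros simp: divide_simps) (auto simp: algebra_simps power2_eq_square)
  have d3: "(coeff_3 has_field_derivative coeff_2 z) (at z)" for z
    unfolding coeff_2_def[abs_def] coeff_3_def[abs_def] using KL nz
    by (auto intro!: derivative_eq_intros simp: divide_simps) (simp add: algebra_simps)
  have w4: "?w 4 j = (K\<^sup>2 + L\<^sup>2) * ?w 2 j - K\<^sup>2 * L\<^sup>2" for j
  proof -
    have "of_real ((velocity a b j)\<^sup>2 + (velocity a b (j + 1))\<^sup>2) = (of_real (a\<^sup>2 + b\<^sup>2) :: complex)"
      "of_real ((velocity a b j)\<^sup>2 * (velocity a b (j + 1))\<^sup>2) = (of_real (a\<^sup>2 * b\<^sup>2) :: complex)"
      by (simp_all only: velocity_squares)
    then show ?thesis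
      unfolding iterate_4 sum prod of_real_diff of_real_add of_real_mult of_real_power by simp
  qed
  \<comment> \<open>At \<open>j + 1\<close> the pair of velocities is \<open>(y, - x)\<close> and at
    \<open>j - 1\<close> it is \<open>(- y, x)\<close>, exactly the arguments in the recursion of
    \<open>iterate\<close>.\<close>
  have step: "\<i> * velocity a b j * ?w n j + lam * (p * ?w n (j + 1) + (1 - p) * ?w n (j - 1)) = ?w (Suc n) j" for n j
    by (simp only: velocity_add_2 velocity_diff_1 iterate.simps of_real_minus of_real_diff of_real_1 diff_add_cancel)
  show "((\<lambda>z. solution z j) has_field_derivative generator (velocity a b) lam p (solution z) j) (at z)" for z j
  proof -
    have "((\<lambda>z. solution z j) has_field_derivative
        - lam * solution z j + exp (- (of_real lam * z)) * (- (K\<^sup>2 * L\<^sup>2) * coeff_3 z * ?w 0 j + coeff_0 z * ?w 1 j +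
          (coeff_1 z + (K\<^sup>2 + L\<^sup>2) * coeff_3 z) * ?w 2 j + coeff_2 z * ?w 3 j)) (at z)"
      unfolding solution_def
      by (rule derivative_eq_intros d0 d1 d2 d3 refl)+ (simp add: algebra_simps)
    also have "- lam * solution z j + exp (- (of_real lam * z)) * (- (K\<^sup>2 * L\<^sup>2) * coeff_3 z * ?w 0 j + coeff_0 z * ?w 1 j +
          (coeff_1 z + (K\<^sup>2 + L\<^sup>2) * coeff_3 z) * ?w 2 j + coeff_2 z * ?w 3 j) =
        - lam * solution z j + exp (- (of_real lam * z)) * (coeff_0 z * ?w (Suc 0) j + coeff_1 z * ?w (Suc 1) j +
          coeff_2 z * ?w (Suc 2) j + coeff_3 z * ?w (Suc 3) j)"
    proof -
      have e: "Suc 0 = 1" "Suc 1 = 2" "Suc 2 = 3" "Suc 3 = 4" by simp_all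
      show ?thesis unfolding e w4 by (simp only: iterate.simps(1)) (simp add: algebra_simps del: iterate.simps)
    qed
    also have "\<dots> = generator (velocity a b) lam p (solution z) j"
      unfolding step[symmetric] generator_def solution_def
      by (simp add: algebra_simps del: iterate.simps)
    finally show ?thesis .
  qed
  show "solution 0 j = 1" for j
    using nz by (simp add: solution_def coeff_0_def coeff_1_def coeff_2_def coeff_3_def)
  show "\<exists>C. \<forall>z j. norm z \<le> t \<longrightarrow> norm (solution z j) \<le> C" for t
  proof -
    have "\<exists>C. \<forall>z. norm z \<le> t \<longrightarrow> norm (solution z j) \<le> C" for j
    proof -
      have "continuous_on (cball 0 t) (\<lambda>z. solution z j)"
        unfolding solution_def
        by (intro continuous_intros DERIV_continuous_on[of _ coeff_0] DERIV_continuous_on[of _ coeff_1]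
            DERIV_continuous_on[of _ coeff_2] DERIV_continuous_on[of _ coeff_3]; rule has_field_derivative_at_within, rule d0 d1 d2 d3)
      then have "bounded ((\<lambda>z. solution z j) ` cball 0 t)"
        by (intro compact_imp_bounded compact_continuous_image) auto
      then obtain C where "\<forall>x\<in>cball 0 t. norm (solution x j) \<le> C" by (auto simp: bounded_iff)
      then show ?thesis by (intro exI[of _ C]) (simp add: Ball_def)
    qed
    then obtain C where C: "\<And>j z. norm z \<le> t \<Longrightarrow> norm (solution z j) \<le> C j" by metis
    \<comment> \<open>\<open>solution z j\<close> depends on \<open>j\<close> only through
      \<open>dir j\<close>, so a bound uniform in all integers is the maximum of four
      bounds.\<close>
    have dep: "\<exists>i\<in>{0, 1, 2, 3}. dir i = dir j" for j
    proof -
      have "dir 0 = (1, 0)" by (simp add: dir_def)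
      then have "dir 0 = (1, 0)" "dir 1 = (0, 1)" "dir 2 = (-1, 0)" "dir 3 = (0, -1)"
        using dir_add_1[of 0] dir_add_1[of 1] dir_add_1[of 2] by simp_all
      then show ?thesis using dir_cases[of j] by auto
    qed
    have "norm (solution z j) \<le> Max (C ` {0, 1, 2, 3})" if "norm z \<le> t" for z j
    proof -
      obtain i where i: "i \<in> {0, 1, 2, 3}" "dir i = dir j" using dep by blast
      then have "solution z j = solution z i"
        by (simp only: solution_def velocity_def dir_add_1)
      then show ?thesis using C[OF that, of i] i(1)
        by (auto intro: order_trans[OF _ Max_ge])
    qed
    then show ?thesis by blast
  qed
  show "(solution z 0 + solution z 1 + solution z 2 + solution z 3) / 4 =
      exp (- (of_real lam * z)) * (coeff_0 z + lam * coeff_1 z + (lam\<^sup>2 - (a\<^sup>2 + b\<^sup>2) / 2) * coeff_2 z +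
        (lam ^ 3 - lam * (a\<^sup>2 + b\<^sup>2)) * coeff_3 z)" for z
  proof -
    \<comment> \<open>The four directions have velocities a, b, -a, -b. In the sums of the iterates
      all terms of odd degree and the products of two consecutive velocities cancel.\<close>
    have v: "velocity a b 0 = a" "velocity a b 1 = b" "velocity a b 2 = - a" "velocity a b 3 = - b"
      "velocity a b 4 = a"
      using dir_add_1[of 0] dir_add_1[of 1] dir_add_1[of 2] dir_add_1[of 3]
      by (simp_all add: velocity_def) (simp_all add: dir_def)
    have "?w 1 0 + ?w 1 1 + ?w 1 2 + ?w 1 3 = 4 * lam"
      unfolding iterate_1 by (simp add: v)
    moreover have "?w 2 0 + ?w 2 1 + ?w 2 2 + ?w 2 3 = 4 * (lam\<^sup>2 - (a\<^sup>2 + b\<^sup>2) / 2)"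
      unfolding iterate_2 by (simp add: v algebra_simps)
    moreover have "?w 3 0 + ?w 3 1 + ?w 3 2 + ?w 3 3 = 4 * (lam ^ 3 - lam * (a\<^sup>2 + b\<^sup>2))"
      unfolding iterate_3 by (simp add: v algebra_simps)
    moreover have "solution z 0 + solution z 1 + solution z 2 + solution z 3 = exp (- (of_real lam * z)) *
      (4 * coeff_0 z + coeff_1 z * (?w 1 0 + ?w 1 1 + ?w 1 2 + ?w 1 3) + coeff_2 z * (?w 2 0 + ?w 2 1 + ?w 2 2 + ?w 2 3) +
       coeff_3 z * (?w 3 0 + ?w 3 1 + ?w 3 2 + ?w 3 3))"
      unfolding solution_def iterate.simps(1) by algebra
    ultimately show ?thesis
      by (simp only:) (simp add: field_simps)
  qed
qed

end

section \<open>The characteristic function\<close>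

lemma (in turning_motion) expectation_start:
  fixes f :: "int \<Rightarrow> complex"
  shows "expectation (\<lambda>\<omega>. f (J \<omega>)) = (f 0 + f 1 + f 2 + f 3) / 4"
proof -
  have "expectation (\<lambda>\<omega>. f (J \<omega>)) = (\<integral>j. f j \<partial>distr M (count_space UNIV) J)"
    by (rule integral_distr[OF random_variable_start, symmetric]) simp
  also have "\<dots> = (f 0 + f 1 + f 2 + f 3) / 4"
    unfolding distr_start 
    by (subst integral_measure_pmf[of "{0, 1, 2, 3}"]) (auto simp: scaleR_conv_of_real field_simps)
  finally show ?thesis .
qed

lemma (in turning_motion) tendsto_phase:
  assumes \<omega>: "\<omega> \<in> space M" and t: "0 < t"
  shows "(\<lambda>n. phase (velocity a b) (t / real (Suc n)) (Suc n) \<omega>)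
    \<longlonglongrightarrow> exp (\<i> * of_real ((a, b) \<bullet> integral {0..t} (\<lambda>\<tau>. dir (index \<tau> \<omega>))))"
proof -
  let ?F = "\<lambda>m. dir (J \<omega> + (\<Sum>k<m. if \<xi> k \<omega> then 1 else - 1))"
  have "(\<lambda>n. (t / real (Suc n)) *\<^sub>R (\<Sum>i<Suc n. ?F (N (real i * (t / real (Suc n))) \<omega>)))
      \<longlonglongrightarrow> integral {0..t} (\<lambda>\<tau>. ?F (N \<tau> \<omega>))"
    by (rule tendsto_riemann_sum[OF N_mono[OF \<omega>], where C = 1]) (use t in \<open>simp_all add: norm_dir\<close>)
  then have "(\<lambda>n. exp (\<i> * of_real ((a, b) \<bullet> ((t / real (Suc n)) *\<^sub>R
        (\<Sum>i<Suc n. dir (index (real i * (t / real (Suc n))) \<omega>))))))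
      \<longlonglongrightarrow> exp (\<i> * of_real ((a, b) \<bullet> integral {0..t} (\<lambda>\<tau>. dir (index \<tau> \<omega>))))"
    unfolding index_def by (intro tendsto_intros)
  then show ?thesis
    by (simp only: phase_def velocity_def inner_scaleR_right inner_sum_right)
qed

text \<open>Two limits of one sequence of expectations are compared: dominated convergence along the
  paths, since phases have modulus 1, and the grid estimate with the solution of the backward
  equation.\<close>

lemma (in turning_motion) expectation_eq_of_backward_equation:
  fixes \<phi> :: "complex \<Rightarrow> int \<Rightarrow> complex"
  assumes deriv: "\<And>z j. ((\<lambda>z. \<phi> z j) has_field_derivative generator (velocity a b) rate p (\<phi> z) j) (at z)"
    and bound: "\<And>z j. norm z \<le> t \<Longrightarrow> norm (\<phi> z j) \<le> C"
    and initial: "\<And>j. \<phi> 0 j = 1"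
    and t: "0 < t"
  shows "expectation (\<lambda>\<omega>. exp (\<i> * of_real ((a, b) \<bullet> integral {0..t} (\<lambda>\<tau>. dir (index \<tau> \<omega>))))) =
    (\<phi> t 0 + \<phi> t 1 + \<phi> t 2 + \<phi> t 3) / 4"
proof -
  let ?Z = "\<lambda>n. phase (velocity a b) (t / real (Suc n)) (Suc n)"
  let ?L = "\<lambda>\<omega>. exp (\<i> * of_real ((a, b) \<bullet> integral {0..t} (\<lambda>\<tau>. dir (index \<tau> \<omega>))))"
  have meas: "?Z n \<in> borel_measurable M" for n
    using measurable_phase_mult[of "t / real (Suc n)" "Suc n" "Suc n" "velocity a b" "\<lambda>_. 1"] t by simp
  have lim: "(\<lambda>n. ?Z n \<omega>) \<longlonglongrightarrow> ?L \<omega>" if "\<omega> \<in> space M" for \<omega>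
    by (rule tendsto_phase[OF that t])
  have "(\<lambda>n. expectation (?Z n)) \<longlonglongrightarrow> expectation ?L"
  proof (rule integral_dominated_convergence[where w = "\<lambda>_. 1"])
    show "?L \<in> borel_measurable M"
      by (rule borel_measurable_LIMSEQ_metric[OF meas lim])
  qed (use meas lim in auto)
  moreover have "(\<lambda>n. expectation (?Z n)) \<longlonglongrightarrow> expectation (\<lambda>\<omega>. \<phi> (of_real t) (J \<omega>))"
  proof (rule tendsto_expectation_phase[OF deriv bound initial _ t])
    show "\<bar>velocity a b j\<bar> \<le> norm (a, b)" for j
      using Cauchy_Schwarz_ineq2[of "(a, b)" "dir j"] by (simp add: velocity_def norm_dir)
  qed
  ultimately have "expectation ?L = expectation (\<lambda>\<omega>. \<phi> (of_real t) (J \<omega>))"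
    by (rule LIMSEQ_unique)
  then show ?thesis by (simp only: expectation_start)
qed

theorem theorem7:
  fixes M :: "'a measure"
    and N :: "real \<Rightarrow> 'a \<Rightarrow> nat"
    and D :: "real \<Rightarrow> 'a \<Rightarrow> real \<times> real"
    and X Y :: "real \<Rightarrow> 'a \<Rightarrow> real"
    and lam c p q t \<alpha> \<beta> :: real
    and R RA RB A B k0 k1 k2 k3 :: complex
  assumes "lam > 0" and "c > 0" and "0 \<le> p" and "p \<le> 1" and "q = 1 - p"
    and "orthogonal_direction_process M lam N p D"
    and "\<And>s \<omega>. s \<ge> 0 \<Longrightarrow> \<omega> \<in> space M \<Longrightarrow>
           (X s \<omega>, Y s \<omega>) = c *\<^sub>R integral {0..s} (\<lambda>\<tau>. D \<tau> \<omega>)"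
    \<comment> \<open>\<open>R\<close>, \<open>RA\<close>, \<open>RB\<close>: any choice of the complex square roots\<close>
    and "R\<^sup>2 = of_real (c ^ 4 * \<alpha>\<^sup>2 * \<beta>\<^sup>2 - lam ^ 4 * (2 * p - 1)\<^sup>2)"
    and "RA\<^sup>2 = of_real (4 * lam\<^sup>2 * p * (1 - p) - c\<^sup>2 * (\<alpha>\<^sup>2 + \<beta>\<^sup>2)) + 2 * R"
    and "RB\<^sup>2 = of_real (4 * lam\<^sup>2 * p * (1 - p) - c\<^sup>2 * (\<alpha>\<^sup>2 + \<beta>\<^sup>2)) - 2 * R"
    and "A = 1 / 2 * RA" and "B = 1 / 2 * RB"
    and "k0 = (of_real (2 * lam\<^sup>2 - c\<^sup>2 * (\<alpha>\<^sup>2 + \<beta>\<^sup>2)) - 2 * (A - B)\<^sup>2) / (8 * A * B)"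
    and "k1 = (of_real (lam ^ 3 - lam * c\<^sup>2 * (\<alpha>\<^sup>2 + \<beta>\<^sup>2)) - of_real lam * (A - B)\<^sup>2) / (4 * A * B * (A + B))"
    and "k2 = (of_real (2 * lam\<^sup>2 - c\<^sup>2 * (\<alpha>\<^sup>2 + \<beta>\<^sup>2)) - 2 * (A + B)\<^sup>2) / (8 * A * B)"
    and "k3 = (of_real (lam ^ 3 - lam * c\<^sup>2 * (\<alpha>\<^sup>2 + \<beta>\<^sup>2)) - of_real lam * (A + B)\<^sup>2) / (4 * A * B * (A - B))"
    and "t > 0"
    and "A * B * (A + B) * (A - B) \<noteq> 0"
  shows "prob_space.expectation M (\<lambda>\<omega>. exp (\<i> * of_real (\<alpha> * X t \<omega> + \<beta> * Y t \<omega>))) =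
         of_real (exp (- lam * t)) *
           (k0 * cosh ((A + B) * of_real t) + k1 * sinh ((A + B) * of_real t)
            - k2 * cosh ((A - B) * of_real t) - k3 * sinh ((A - B) * of_real t))"
proof -
  interpret orthogonal_direction_process M lam N p D by fact
  obtain J \<xi> where J\<xi>: "random_variable (count_space UNIV) J"
      "\<forall>k. random_variable (count_space UNIV) (\<xi> k)"
      "distr M (count_space UNIV) J = measure_pmf (pmf_of_set {0, 1, 2, 3})"
      "\<forall>k. distr M (count_space UNIV) (\<xi> k) = measure_pmf (bernoulli_pmf p)"
      "indep_sets (source_events N J \<xi>) UNIV"
    and D: "\<forall>\<omega>\<in>space M. \<forall>t\<ge>0. D t \<omega> = dir (J \<omega> + (\<Sum>k<N t \<omega>. if \<xi> k \<omega> then 1 else - 1))"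
    using direction_process by auto
  interpret turning_motion M lam N p J \<xi>
    by unfold_locales (use assms(1,3,4) J\<xi> in auto)
  define a where "a = c * \<alpha>"
  define b where "b = c * \<beta>"
  \<comment> \<open>The characteristic roots are \<open>K\<close>, \<open>L\<close> and their
    negatives; the nonvanishing hypothesis makes them nonzero with distinct squares, as
    \<open>4 * A * B\<close> is the difference of the squares.\<close>
  define K where "K = A + B"
  define L where "L = A - B"
  have ABne: "A \<noteq> 0" "B \<noteq> 0" "K \<noteq> 0" "L \<noteq> 0"
    using assms(18) by (auto simp: K_def L_def)
  have KL: "K\<^sup>2 - L\<^sup>2 = 4 * A * B"
    by (simp add: K_def L_def power2_eq_square algebra_simps)
  then have ne: "K\<^sup>2 \<noteq> L\<^sup>2" using ABne by auto
  have RA: "RA = 2 * A" and RB: "RB = 2 * B" unfolding assms(11,12) by simp_all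
  have sum: "K\<^sup>2 + L\<^sup>2 = of_real (lam\<^sup>2 * (1 - (2 * p - 1)\<^sup>2) - (a\<^sup>2 + b\<^sup>2))"
  proof -
    have "2 * (K\<^sup>2 + L\<^sup>2) = RA\<^sup>2 + RB\<^sup>2"
      by (simp add: RA RB K_def L_def power2_eq_square algebra_simps)
    also have "\<dots> = 2 * of_real (4 * lam\<^sup>2 * p * (1 - p) - c\<^sup>2 * (\<alpha>\<^sup>2 + \<beta>\<^sup>2))"
      unfolding assms(9,10) by simp
    also have "4 * lam\<^sup>2 * p * (1 - p) - c\<^sup>2 * (\<alpha>\<^sup>2 + \<beta>\<^sup>2) = lam\<^sup>2 * (1 - (2 * p - 1)\<^sup>2) - (a\<^sup>2 + b\<^sup>2)"
      by (simp add: a_def b_def power2_eq_square algebra_simps)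
    finally show ?thesis by (simp only: mult_cancel_left) simp
  qed
  \<comment> \<open>The product \<open>K * L\<close> is the difference of the squares of
    \<open>A\<close> and \<open>B\<close>, which is \<open>R\<close>. Only the square of
    \<open>R\<close> enters the result, in accordance with the free choice of the root.\<close>
  have prod: "K\<^sup>2 * L\<^sup>2 = of_real (a\<^sup>2 * b\<^sup>2 - lam ^ 4 * (2 * p - 1)\<^sup>2)"
  proof -
    have "4 * (K * L) = RA\<^sup>2 - RB\<^sup>2"
      by (simp add: RA RB K_def L_def power2_eq_square algebra_simps)
    also have "\<dots> = 4 * R" unfolding assms(9,10) by simp
    finally have "K * L = R" by simp
    then have "K\<^sup>2 * L\<^sup>2 = R\<^sup>2" by (simp add: power_mult_distrib[symmetric])
    also have "\<dots> = of_real (a\<^sup>2 * b\<^sup>2 - lam ^ 4 * (2 * p - 1)\<^sup>2)"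
      unfolding assms(8) a_def b_def by (rule arg_cong[where f = of_real]) algebra
    finally show ?thesis .
  qed
  note sol = cosh_sinh_solution[OF ne ABne(3,4) sum prod]
  obtain C where C: "\<And>z j. norm z \<le> t \<Longrightarrow> norm (solution K L a b lam p z j) \<le> C"
    using sol(3)[of t] by blast
  have "\<alpha> * X t \<omega> + \<beta> * Y t \<omega> = (a, b) \<bullet> integral {0..t} (\<lambda>\<tau>. dir (index \<tau> \<omega>))"
    if \<omega>: "\<omega> \<in> space M" for \<omega>
  proof -
    have "integral {0..t} (\<lambda>\<tau>. D \<tau> \<omega>) = integral {0..t} (\<lambda>\<tau>. dir (index \<tau> \<omega>))"
      by (rule Henstock_Kurzweil_Integration.integral_cong) (use D \<omega> in \<open>auto simp: index_def\<close>)
    then have XY: "(X t \<omega>, Y t \<omega>) = c *\<^sub>R integral {0..t} (\<lambda>\<tau>. dir (index \<tau> \<omega>))"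
      using assms(7)[of t \<omega>] assms(17) \<omega> by simp
    have "\<alpha> * X t \<omega> + \<beta> * Y t \<omega> = (\<alpha>, \<beta>) \<bullet> (X t \<omega>, Y t \<omega>)" by simp
    also have "\<dots> = (c *\<^sub>R (\<alpha>, \<beta>)) \<bullet> integral {0..t} (\<lambda>\<tau>. dir (index \<tau> \<omega>))"
      unfolding XY by (simp only: inner_scaleR_left inner_scaleR_right)
    finally show ?thesis by (simp add: a_def b_def)
  qed
  then have "expectation (\<lambda>\<omega>. exp (\<i> * of_real (\<alpha> * X t \<omega> + \<beta> * Y t \<omega>))) =
      expectation (\<lambda>\<omega>. exp (\<i> * of_real ((a, b) \<bullet> integral {0..t} (\<lambda>\<tau>. dir (index \<tau> \<omega>)))))"
    by (intro Bochner_Integration.integral_cong) auto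
  also have "\<dots> = (solution K L a b lam p t 0 + solution K L a b lam p t 1 + solution K L a b lam p t 2 + solution K L a b lam p t 3) / 4"
    by (rule expectation_eq_of_backward_equation[OF sol(1) C sol(2) assms(17)])
  also have "\<dots> = exp (- (of_real lam * of_real t)) * (coeff_0 K L t + lam * coeff_1 K L t +
      (lam\<^sup>2 - (a\<^sup>2 + b\<^sup>2) / 2) * coeff_2 K L t + (lam ^ 3 - lam * (a\<^sup>2 + b\<^sup>2)) * coeff_3 K L t)"
    unfolding sol(4) by simp
  also have "exp (- (of_real lam * of_real t) :: complex) = of_real (exp (- lam * t))"
    by (simp add: exp_of_real[symmetric])
  also have "coeff_0 K L t + lam * coeff_1 K L t + (lam\<^sup>2 - (a\<^sup>2 + b\<^sup>2) / 2) * coeff_2 K L t + (lam ^ 3 - lam * (a\<^sup>2 + b\<^sup>2)) * coeff_3 K L t =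
      k0 * cosh ((A + B) * of_real t) + k1 * sinh ((A + B) * of_real t)
       - k2 * cosh ((A - B) * of_real t) - k3 * sinh ((A - B) * of_real t)"
  proof -
    define s :: complex where "s = of_real (a\<^sup>2 + b\<^sup>2)"
    have s: "of_real (c\<^sup>2 * (\<alpha>\<^sup>2 + \<beta>\<^sup>2)) = s"
      by (simp add: s_def a_def b_def power_mult_distrib algebra_simps)
    have k0: "k0 = (lam\<^sup>2 - s / 2 - L\<^sup>2) / (4 * A * B)"
      unfolding assms(13) of_real_diff s L_def[symmetric] using ABne by (simp add: field_simps)
    have k2: "k2 = (lam\<^sup>2 - s / 2 - K\<^sup>2) / (4 * A * B)"
      unfolding assms(15) of_real_diff s K_def[symmetric] using ABne by (simp add: field_simps)
    have ls: "of_real (lam * c\<^sup>2 * (\<alpha>\<^sup>2 + \<beta>\<^sup>2)) = lam * s"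
      unfolding s[symmetric] by simp
    have k1: "k1 = (lam ^ 3 - lam * s - lam * L\<^sup>2) / (4 * A * B) / K"
      unfolding assms(14) of_real_diff ls L_def[symmetric] K_def[symmetric] by simp
    have k3: "k3 = (lam ^ 3 - lam * s - lam * K\<^sup>2) / (4 * A * B) / L"
      unfolding assms(16) of_real_diff ls L_def[symmetric] K_def[symmetric] by simp
    \<comment> \<open>Regroups the sum by hyperbolic functions instead of by powers of the
      generator: \<open>x0\<close>, \<open>x1\<close> stand for cosh and sinh of
      \<open>K * t\<close>, \<open>y0\<close>, \<open>y1\<close> for those of \<open>L * t\<close>,
      and \<open>d\<close> for \<open>4 * A * B\<close>.\<close>
    have comb: "(K\<^sup>2 * y0 - L\<^sup>2 * x0) / d + l * ((K\<^sup>2 * (y1 / L) - L\<^sup>2 * (x1 / K)) / d) + u * ((x0 - y0) / d) + v * ((x1 / K - y1 / L) / d)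
      = (u - L\<^sup>2) / d * x0 + (v - l * L\<^sup>2) / d / K * x1 - (u - K\<^sup>2) / d * y0 - (v - l * K\<^sup>2) / d / L * y1"
      for x0 x1 y0 y1 d l u v :: complex
      by (simp add: diff_divide_distrib add_divide_distrib algebra_simps)
    show ?thesis
      unfolding coeff_0_def coeff_1_def coeff_2_def coeff_3_def KL comb k0 k1 k2 k3
      unfolding K_def L_def s_def by simp
  qed
  finally show ?thesis .
qed

end
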